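(* Let $(\mathcal{N},\mathcal{E},\tau)$ be a supply network on a finite directed acyclic graph with delays $\tau_{ij}=\tau^0_{ij}-\delta_{ij}>0$, in which every ordering node $i$ follows the ordering dynamics given in the context with $K_i>0$, $\beta_i\in[0,1)$ and weights $w_{ij}\ge0$, $\sum_{j\in\mathcal{S}(i)}w_{ij}=1$, and whose nodes are indexed in a topological order. Let $\Omega=\{\omega_k\}$ be a finite frequency grid, $\rho>0$, let $T(\mathrm{j}\omega)$ be the network transfer matrix and $\bar\sigma_k=\bar\sigma(T(\mathrm{j}\omega_k))$ its largest singular value, and let $$J_\rho(w,\delta,K)=m+\frac1\rho\log\sum_{\omega_k\in\Omega}\exp\bigl(\rho(\bar\sigma_k-m)\bigr),\qquad m=\max_k\bar\sigma_k .$$ Suppose $\bar\sigma_k$ is simple (strictly larger than the second singular value of $T(\mathrm{j}\omega_k)$) for every $k$. Then for every edge $(i,j)\in\mathcal{E}$ and every ordering node $i$, $$\frac{\partial J_\rho}{\partial w_{ij}}=\sum_{\omega_k\in\Omega}\operatorname{Re}\bigl[(1-\beta_i)\,e^{-\mathrm{j}\omega_k\tau_{ij}}\,\Lambda_i^k+T_j(\mathrm{j}\omega_k)\,\psi_j^k\,o_i^k\bigr],$$ $$\frac{\partial J_\rho}{\partial\delta_{ij}}=\sum_{\omega_k\in\Omega}\operatorname{Re}\bigl[\mathrm{j}\omega_k(1-\beta_i)\,w_{ij}\,e^{-\mathrm{j}\omega_k\tau_{ij}}\,\Lambda_i^k\bigr],$$ $$\frac{\partial J_\rho}{\partial K_i}=\sum_{\omega_k\in\Omega}\operatorname{Re}\Bigl[\frac{\mathrm{j}\omega_k\bigl(1-W_i(\mathrm{j}\omega_k)\bigr)T_i(\mathrm{j}\omega_k)\,o_i^k}{(\mathrm{j}\omega_k+K_i)^2}\,\psi_i^k\Bigr],$$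 where $o^k=\bar\sigma_k\eta_k$ with $\eta_k$ the unit left singular vector of $T(\mathrm{j}\omega_k)$ associated with $\bar\sigma_k$, where $\psi^k$ is defined by the backward recursion $$\psi_i^k=c_k\,\overline{\eta_{k,i}}+\sum_{j\in\mathcal{S}(i)}w_{ij}\,T_j(\mathrm{j}\omega_k)\,\psi_j^k,\qquad c_k=\frac{e^{\rho\bar\sigma_k}}{\sum_{k'}e^{\rho\bar\sigma_{k'}}},$$ with $T_j\psi_j^k=0$ for $j\in\mathcal{S}_0$ and $\overline{(\cdot)}$ the complex conjugate, and $$\Lambda_i^k=-\frac{K_i\,T_i(\mathrm{j}\omega_k)\,o_i^k}{\mathrm{j}\omega_k+K_i}\,\psi_i^k .$$
   Context: Here $\mathrm{j}$ (upright) is the imaginary unit and $j$ an index. Network. $\mathcal{N}$ is a finite node set, $\mathcal{E}\subset\{(u,v):u,v\in\mathcal{N},u\ne v\}$; an edge $(i,j)$ runs from customer $i$ to supplier $j$ and carries a delay $\tau_{ij}>0$ and weight $w_{ij}$. $\mathcal{S}(i)=\{j:(i,j)\in\mathcal{E}\}$ (suppliers), $\mathcal{C}(i)=\{k:(k,i)\in\mathcal{E}\}$ (customers). Sources are $\mathcal{S}_0=\{j:\mathcal{S}(j)=\emptyset\}$; they place no orders. All other nodes are ordering nodes. Topological indexing: $(c,j)\in\mathcal{E}$ implies $c<j$. Dynamics of ordering node $i$: $\dot{\mathit{IP}}_i(t)=\sum_{j\in\mathcal{S}(i)}w_{ij}o_i(t-\tau_{ij})-d_i(t)$, $\mathit{SL}_i(t)=\sum_{j\in\mathcal{S}(i)}w_{ij}\int_{t-\tau_{ij}}^t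 o_i(m)\,\mathrm{d}m$, $o_i(t)=d_i(t)-K_i(\mathit{IP}_i(t)+\beta_i\mathit{SL}_i(t))$, $d_i=\sum_{k\in\mathcal{C}(i)}w_{ki}o_k+v_i$, where $v_i$ is exogenous demand, all with zero initial conditions. In the Laplace domain node $i$ satisfies $o_i=T_i d_i$ with $T_i(s)=\dfrac{s+K_i}{s+K_iW_i(s)}$, $W_i(s)=\beta_i+(1-\beta_i)\sum_{j\in\mathcal{S}(i)}w_{ij}e^{-s\tau_{ij}}$. Network transfer matrix: the square matrix $T(s)$, indexed by ordering nodes, with $o=T(s)v$, i.e. the solution map of $o_j=T_j\bigl(\sum_{k\in\mathcal{C}(j)}w_{kj}o_k+v_j\bigr)$ over ordering nodes $j$. Design variables: $\theta=(w,\delta,K)$ with $w=(w_e)_{e\in\mathcal{E}}$, $\delta=(\delta_e)_{e\in\mathcal{E}}$, $K=(K_i)$ over ordering nodes; the delays are $\tau_e=\tau^0_e-\delta_e$ with nominal lead times $\tau^0_e$ fixed, and the $\beta_i$ are fixed. Partial derivatives are taken with all components of $\theta$ treated as independent variables, using the formulas above for $W_i$, $T_i$ and $T$ (so the constraint $\sum_j w_{ij}=1$ is not imposed when differentiating). The values $T_i(\mathrm{j}\omega_k)$ are assumed to be defined, i.e. $\mathrm{j}\omega_k+K_iW_i(\mathrm{j}\omega_k)\ne0$. *)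

theory Defs
  imports
    Complex_Main
    "Jordan_Normal_Form.Schur_Decomposition"
begin

section \<open>Singular values\<close>

text \<open>The singular values of a square matrix, in decreasing order and repeated according to
  multiplicity. The eigenvalues of \<open>A\<^sup>H A\<close> are real and nonnegative, so \<open>Re\<close> loses nothing.\<close>

definition singular_values :: "complex mat \<Rightarrow> real list" where
  "singular_values A =
     rev (sorted_list_of_multiset
       (image_mset (\<lambda>z. sqrt (Re z)) (proots (char_poly (mat_adjoint A * A)))))"

definition sigma_max :: "complex mat \<Rightarrow> real" where
  "sigma_max A = singular_values A ! 0"

text \<open>A \<open>1 \<times> 1\<close> matrix has no second singular value; its only one counts as simple.\<close>

definition sigma_max_simple :: "complex mat \<Rightarrow> bool" where
  "sigma_max_simple A \<longleftrightarrow>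
     (length (singular_values A) \<ge> 2 \<longrightarrow> singular_values A ! 1 < singular_values A ! 0)"

definition unit_left_singular_vector :: "complex mat \<Rightarrow> real \<Rightarrow> complex vec \<Rightarrow> bool" where
  "unit_left_singular_vector A \<sigma> u \<longleftrightarrow>
     u \<in> carrier_vec (dim_row A) \<and> u \<bullet>c u = 1 \<and>
     (\<exists>v \<in> carrier_vec (dim_col A). v \<bullet>c v = 1 \<and>
        A *\<^sub>v v = complex_of_real \<sigma> \<cdot>\<^sub>v u \<and>
        mat_adjoint A *\<^sub>v u = complex_of_real \<sigma> \<cdot>\<^sub>v v)"


section \<open>Supply networks\<close>

text \<open>An edge \<open>(i, j)\<close> runs from customer \<open>i\<close> to supplier \<open>j\<close>. Nodes are elements of a linearly
  ordered type, whose order plays the role of the topological indexing.\<close>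

definition suppliers :: "('a \<times> 'a) set \<Rightarrow> 'a \<Rightarrow> 'a set" where
  "suppliers E i = {j. (i, j) \<in> E}"

definition customers :: "('a \<times> 'a) set \<Rightarrow> 'a \<Rightarrow> 'a set" where
  "customers E i = {k. (k, i) \<in> E}"

definition source_nodes :: "'a set \<Rightarrow> ('a \<times> 'a) set \<Rightarrow> 'a set" where
  "source_nodes N E = {j \<in> N. suppliers E j = {}}"

definition ordering_nodes :: "'a set \<Rightarrow> ('a \<times> 'a) set \<Rightarrow> 'a set" where
  "ordering_nodes N E = N - source_nodes N E"

definition supply_weight ::
  "('a \<times> 'a) set \<Rightarrow> ('a \<Rightarrow> real) \<Rightarrow> ('a \<times> 'a \<Rightarrow> real) \<Rightarrow> ('a \<times> 'a \<Rightarrow> real) \<Rightarrow>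
   'a \<Rightarrow> complex \<Rightarrow> complex" where
  "supply_weight E \<beta> \<tau> w i s =
     of_real (\<beta> i) +
     of_real (1 - \<beta> i) * (\<Sum>j\<in>suppliers E i. of_real (w (i, j)) * exp (- (s * of_real (\<tau> (i, j)))))"

definition node_transfer ::
  "('a \<times> 'a) set \<Rightarrow> ('a \<Rightarrow> real) \<Rightarrow> ('a \<times> 'a \<Rightarrow> real) \<Rightarrow> ('a \<times> 'a \<Rightarrow> real) \<Rightarrow> ('a \<Rightarrow> real) \<Rightarrow>
   'a \<Rightarrow> complex \<Rightarrow> complex" where
  "node_transfer E \<beta> \<tau> w K i s =
     (s + of_real (K i)) / (s + of_real (K i) * supply_weight E \<beta> \<tau> w i s)"

text \<open>\<open>q\<close> is the vector of orders generated by the exogenous demand \<open>v\<close>, in the Laplace domain.\<close>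

definition order_equations ::
  "'a set \<Rightarrow> ('a \<times> 'a) set \<Rightarrow> ('a \<Rightarrow> real) \<Rightarrow> ('a \<times> 'a \<Rightarrow> real) \<Rightarrow> ('a \<times> 'a \<Rightarrow> real) \<Rightarrow>
   ('a \<Rightarrow> real) \<Rightarrow> complex \<Rightarrow> ('a \<Rightarrow> complex) \<Rightarrow> ('a \<Rightarrow> complex) \<Rightarrow> bool" where
  "order_equations N E \<beta> \<tau> w K s v q \<longleftrightarrow>
     (\<forall>j \<in> ordering_nodes N E.
        q j = node_transfer E \<beta> \<tau> w K j s *
              ((\<Sum>k\<in>customers E j. of_real (w (k, j)) * q k) + v j))"

text \<open>Vectors and matrices indexed by ordering nodes are rendered with positions \<open>0, 1, \<dots>\<close>
  by listing the ordering nodes increasingly.\<close>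

definition node_vec ::
  "'a::linorder set \<Rightarrow> ('a \<times> 'a) set \<Rightarrow> ('a \<Rightarrow> complex) \<Rightarrow> complex vec" where
  "node_vec N E f = vec_of_list (map f (sorted_list_of_set (ordering_nodes N E)))"

definition transfer_matrix ::
  "'a::linorder set \<Rightarrow> ('a \<times> 'a) set \<Rightarrow> ('a \<Rightarrow> real) \<Rightarrow> ('a \<times> 'a \<Rightarrow> real) \<Rightarrow>
   ('a \<times> 'a \<Rightarrow> real) \<Rightarrow> ('a \<Rightarrow> real) \<Rightarrow> complex \<Rightarrow> complex mat" where
  "transfer_matrix N E \<beta> \<tau> w K s =
     (THE M. M \<in> carrier_mat (card (ordering_nodes N E)) (card (ordering_nodes N E)) \<and>
        (\<forall>v q. order_equations N E \<beta> \<tau> w K s v q \<longleftrightarrow> node_vec N E q = M *\<^sub>v node_vec N E v))"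

definition lead_time ::
  "('a \<times> 'a \<Rightarrow> real) \<Rightarrow> ('a \<times> 'a \<Rightarrow> real) \<Rightarrow> 'a \<times> 'a \<Rightarrow> real" where
  "lead_time \<tau>0 \<delta> e = \<tau>0 e - \<delta> e"

definition network_gain ::
  "'a::linorder set \<Rightarrow> ('a \<times> 'a) set \<Rightarrow> ('a \<Rightarrow> real) \<Rightarrow> ('a \<times> 'a \<Rightarrow> real) \<Rightarrow>
   ('a \<times> 'a \<Rightarrow> real) \<Rightarrow> ('a \<times> 'a \<Rightarrow> real) \<Rightarrow> ('a \<Rightarrow> real) \<Rightarrow> real \<Rightarrow> real" where
  "network_gain N E \<beta> \<tau>0 w \<delta> K \<omega> =
     sigma_max (transfer_matrix N E \<beta> (lead_time \<tau>0 \<delta>) w K (\<i> * of_real \<omega>))"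

definition smooth_peak_gain ::
  "'a::linorder set \<Rightarrow> ('a \<times> 'a) set \<Rightarrow> ('a \<Rightarrow> real) \<Rightarrow> ('a \<times> 'a \<Rightarrow> real) \<Rightarrow> real set \<Rightarrow> real \<Rightarrow>
   ('a \<times> 'a \<Rightarrow> real) \<Rightarrow> ('a \<times> 'a \<Rightarrow> real) \<Rightarrow> ('a \<Rightarrow> real) \<Rightarrow> real" where
  "smooth_peak_gain N E \<beta> \<tau>0 \<Omega> \<rho> w \<delta> K =
     (let \<sigma> = network_gain N E \<beta> \<tau>0 w \<delta> K; m = Max (\<sigma> ` \<Omega>)
      in m + 1 / \<rho> * ln (\<Sum>\<omega>\<in>\<Omega>. exp (\<rho> * (\<sigma> \<omega> - m))))"


section \<open>Well-definedness of the transfer matrix\<close>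

text \<open>On a topologically indexed network the description of the transfer matrix picks out
  exactly one matrix.\<close>

lemma topological_imp_acyclic:
  fixes E :: "('a::linorder \<times> 'a) set"
  assumes "\<And>c j. (c, j) \<in> E \<Longrightarrow> c < j"
  shows "acyclic E"
proof -
  have "a < b" if "(a, b) \<in> E\<^sup>+" for a b
    using that by (induction rule: trancl_induct) (auto dest: assms)
  then show ?thesis by (auto simp: acyclic_def)
qed

lemma transfer_matrix_ex1:
  fixes N :: "'a::linorder set"
  assumes fin: "finite N" and EN: "E \<subseteq> N \<times> N"
    and topo: "\<And>c j. (c, j) \<in> E \<Longrightarrow> c < j"
  shows "\<exists>!M. M \<in> carrier_mat (card (ordering_nodes N E)) (card (ordering_nodes N E)) \<and>
    (\<forall>v q. order_equations N E \<beta> \<tau> w K s v q \<longleftrightarrow> node_vec N E q = M *\<^sub>v node_vec N E v)"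
proof -
  define R where "R = ordering_nodes N E"
  define xs where "xs = sorted_list_of_set R"
  define n where "n = card R"
  define T where "T = (\<lambda>j. node_transfer E \<beta> \<tau> w K j s)"
  have finR: "finite R" using fin by (simp add: R_def ordering_nodes_def)
  have set_xs: "set xs = R" and dist: "distinct xs" and len: "length xs = n"
    and sorted: "sorted_wrt (<) xs"
    using finR by (auto simp: xs_def n_def)
  have cust: "customers E j \<subseteq> R" for j
    using EN by (auto simp: customers_def R_def ordering_nodes_def source_nodes_def suppliers_def)
  have nv: "node_vec N E f = vec n (\<lambda>a. f (xs ! a))" for f
    by (auto simp: node_vec_def R_def[symmetric] xs_def[symmetric] len vec_of_list_index)
  have bij: "bij_betw ((!) xs) {0..<n} R"
    using bij_betw_nth[OF dist, of "{0..<n}" R] by (simp add: len set_xs atLeast0LessThan)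
  define L where "L = (\<lambda>a b. if (xs ! b, xs ! a) \<in> E then T (xs ! a) * of_real (w (xs ! b, xs ! a)) else 0)"
  define A where "A = mat n n (\<lambda>(a, b). (if a = b then 1 else 0) - L a b)"
  define D where "D = mat n n (\<lambda>(a, b). if a = b then T (xs ! a) else 0)"
  have A: "A \<in> carrier_mat n n" and D: "D \<in> carrier_mat n n" by (auto simp: A_def D_def)
  have L0: "L a b = 0" if "a \<le> b" "b < n" for a b
  proof -
    have "xs ! a \<le> xs ! b"
      using that sorted len by (cases "a = b") (auto simp: sorted_wrt_iff_nth_less intro!: less_imp_le)
    then show ?thesis using topo by (force simp: L_def)
  qed
  have "det A = prod_list (diag_mat A)"
    by (rule det_lower_triangular[OF _ A]) (auto simp: A_def L0)
  also have "diag_mat A = map (\<lambda>_. 1) [0..<n]"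
    by (auto simp: diag_mat_def A_def L0)
  also have "prod_list \<dots> = 1" by (simp add: map_replicate_const)
  finally have "det A \<noteq> 0" by simp
  from det_non_zero_imp_unit[OF A this]
  obtain B where B: "B \<in> carrier_mat n n" and BA: "B * A = 1\<^sub>m n" and AB: "A * B = 1\<^sub>m n"
    by (auto simp: Units_def ring_mat_def)
  have A_mult: "(A *\<^sub>v node_vec N E q) $ a =
      q (xs ! a) - T (xs ! a) * (\<Sum>k\<in>customers E (xs ! a). of_real (w (k, xs ! a)) * q k)"
    if a: "a < n" for q a
  proof -
    have "(A *\<^sub>v node_vec N E q) $ a =
        (\<Sum>b = 0..<n. ((if a = b then 1 else 0) - L a b) * q (xs ! b))"
      using a by (simp add: A_def nv scalar_prod_def)
    also have "\<dots> = (\<Sum>b = 0..<n. if a = b then q (xs ! b) else 0) - (\<Sum>b = 0..<n. L a b * q (xs ! b))"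
      unfolding sum_subtractf[symmetric] by (rule sum.cong) (auto simp: algebra_simps)
    also have "(\<Sum>b = 0..<n. if a = b then q (xs ! b) else 0) = q (xs ! a)"
      using a by simp
    also have "(\<Sum>b = 0..<n. L a b * q (xs ! b)) =
        (\<Sum>k\<in>R. (if (k, xs ! a) \<in> E then T (xs ! a) * of_real (w (k, xs ! a)) else 0) * q k)"
      unfolding L_def by (rule sum.reindex_bij_betw[OF bij])
    also have "\<dots> = (\<Sum>k\<in>customers E (xs ! a). T (xs ! a) * of_real (w (k, xs ! a)) * q k)"
      by (rule sum.mono_neutral_cong_right) (use finR cust in \<open>auto simp: customers_def\<close>)
    finally show ?thesis by (simp add: sum_distrib_left mult.assoc)
  qed
  have D_mult: "(D *\<^sub>v node_vec N E v) $ a = T (xs ! a) * v (xs ! a)" if a: "a < n" for v a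
    using a by (simp add: D_def nv scalar_prod_def if_distrib[of "\<lambda>x. x * _"] cong: if_cong)
  have eqs: "order_equations N E \<beta> \<tau> w K s v q \<longleftrightarrow> A *\<^sub>v node_vec N E q = D *\<^sub>v node_vec N E v" for v q
  proof -
    have "order_equations N E \<beta> \<tau> w K s v q \<longleftrightarrow>
        (\<forall>j\<in>R. q j = T j * ((\<Sum>k\<in>customers E j. of_real (w (k, j)) * q k) + v j))"
      by (simp add: order_equations_def R_def T_def)
    also have "\<dots> \<longleftrightarrow> (\<forall>a<n. q (xs ! a) =
        T (xs ! a) * ((\<Sum>k\<in>customers E (xs ! a). of_real (w (k, xs ! a)) * q k) + v (xs ! a)))"
      by (simp add: set_xs[symmetric] all_set_conv_all_nth len)
    also have "\<dots> \<longleftrightarrow> (\<forall>a<n. (A *\<^sub>v node_vec N E q) $ a = (D *\<^sub>v node_vec N E v) $ a)"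
      by (simp add: A_mult D_mult algebra_simps)
    also have "\<dots> \<longleftrightarrow> A *\<^sub>v node_vec N E q = D *\<^sub>v node_vec N E v"
      using A D by (auto simp: vec_eq_iff)
    finally show ?thesis .
  qed
  have nvc: "node_vec N E f \<in> carrier_vec n" for f by (simp add: nv)
  have sol: "order_equations N E \<beta> \<tau> w K s v q \<longleftrightarrow> node_vec N E q = (B * D) *\<^sub>v node_vec N E v" for v q
  proof -
    have 1: "B *\<^sub>v (A *\<^sub>v node_vec N E q) = node_vec N E q"
      using assoc_mult_mat_vec[OF B A nvc] BA nvc by simp
    have 2: "(B * D) *\<^sub>v node_vec N E v = B *\<^sub>v (D *\<^sub>v node_vec N E v)"
      using assoc_mult_mat_vec[OF B D nvc] .
    have Dc: "D *\<^sub>v node_vec N E v \<in> carrier_vec n" using D nvc by simp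
    have 3: "A *\<^sub>v (B *\<^sub>v (D *\<^sub>v node_vec N E v)) = D *\<^sub>v node_vec N E v"
      using assoc_mult_mat_vec[OF A B Dc] AB Dc by simp
    show ?thesis unfolding eqs by (metis 1 2 3)
  qed
  have surj: "\<exists>f. node_vec N E f = x" if "x \<in> carrier_vec n" for x
  proof -
    have "node_vec N E (\<lambda>i. x $ (inv_into {0..<n} ((!) xs) i)) = x"
      using that bij by (auto simp: nv bij_betw_def inv_into_f_f intro!: eq_vecI)
    then show ?thesis by blast
  qed
  show ?thesis
    unfolding R_def[symmetric] n_def[symmetric]
  proof (rule ex1I)
    show "B * D \<in> carrier_mat n n \<and>
      (\<forall>v q. order_equations N E \<beta> \<tau> w K s v q \<longleftrightarrow> node_vec N E q = (B * D) *\<^sub>v node_vec N E v)"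
      using B D sol by simp
  next
    fix M assume M: "M \<in> carrier_mat n n \<and>
      (\<forall>v q. order_equations N E \<beta> \<tau> w K s v q \<longleftrightarrow> node_vec N E q = M *\<^sub>v node_vec N E v)"
    show "M = B * D"
    proof (rule eq_matI)
      show "dim_row M = dim_row (B * D)" "dim_col M = dim_col (B * D)" using M B D by auto
    next
      fix a b assume "a < dim_row (B * D)" "b < dim_col (B * D)"
      then have ab: "a < n" "b < n" using B D by auto
      obtain v where v: "node_vec N E v = unit_vec n b" using surj[of "unit_vec n b"] by auto
      obtain q where q: "node_vec N E q = M *\<^sub>v unit_vec n b"
        using surj[of "M *\<^sub>v unit_vec n b"] M by auto
      have "M *\<^sub>v unit_vec n b = (B * D) *\<^sub>v unit_vec n b"
        using M sol[of v q] v q by auto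
      moreover have "(X *\<^sub>v unit_vec n b) $ a = X $$ (a, b)" if "X \<in> carrier_mat n n" for X :: "complex mat"
        using that ab by (simp add: scalar_prod_right_unit)
      ultimately show "M $$ (a, b) = (B * D) $$ (a, b)" using M B D by (metis mult_carrier_mat)
    qed
  qed
qed

end

theory Submission
  imports Defs
begin

text \<open>Fix a frequency and let \<open>v\<close> be the unit right singular vector with \<open>T v = \<sigma> \<eta>\<close>. Along a path
  \<open>T(x)\<close> of transfer matrices the maximal singular value satisfies
  \<open>\<parallel>T(x) v\<parallel>\<^sup>2 \<le> \<sigma>(x)\<^sup>2 \<le> \<parallel>T(x) v\<parallel>\<^sup>2 + O((x - x\<^sub>0)\<^sup>2)\<close>, the upper bound by the spectral gap at
  \<open>x\<^sub>0\<close>. Hence \<open>\<sigma>\<close> is differentiable with \<open>\<sigma>' = Re (\<eta>\<^sup>H o')\<close>, where \<open>o(x) = T(x) v\<close> solves the order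
  equations with fixed demand \<open>v\<close>. Differentiating these equations and pairing them with \<open>\<psi>\<close>, the
  solution of the transposed equations with right-hand side \<open>c\<close> times the conjugate of \<open>\<eta>\<close>,
  eliminates \<open>o'\<close>. The weights \<open>c\<close> are the derivatives of the log-sum-exp function.\<close>

section \<open>Unitary diagonalization of Hermitian matrices\<close>

text \<open>Freezing the right singular vector avoids differentiating eigenvalues and eigenvectors.
  The error is quadratic for this reason: a unit maximiser at \<open>x\<close> is split along
  \<open>v\<close> and orthogonally to it. The mixed term of the quadratic form vanishes at
  \<open>x0\<close>, where \<open>v\<close> is an eigenvector of the Gram matrix, so at
  \<open>x\<close> it is at most of the order of the perturbation times the length \<open>t\<close>
  of the orthogonal part, while the spectral gap costs a multiple of \<open>t\<close> squared.
  Balancing the two leaves the square of the perturbation, and the perturbation is linear in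
  \<open>x - x0\<close>. Passing from the square of \<sigma> to \<sigma> requires \<sigma> > 0.
  Since \<open>K i > 0\<close>, the numerator of each node transfer function is nonzero on the
  imaginary axis, so no \<open>T j\<close> vanishes; then zero orders force zero demand, and the
  transfer matrix cannot annihilate the unit vector \<open>v\<close>. All three partial derivatives
  are instances of one formula along a path of parameters, into which only the derivatives of the
  node transfer functions and of the weights enter.\<close>

lemma mat_adjoint_index [simp]:
  "i < dim_col A \<Longrightarrow> j < dim_row A \<Longrightarrow> mat_adjoint A $$ (i, j) = conjugate (A $$ (j, i))"
  by (simp add: mat_adjoint_def mat_of_rows_index)

lemma mat_adjoint_dim [simp]:
  "dim_row (mat_adjoint A) = dim_col A" "dim_col (mat_adjoint A) = dim_row A"
  by (simp_all add: mat_adjoint_def)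

lemma mat_adjoint_carrier [simp]: "A \<in> carrier_mat n m \<Longrightarrow> mat_adjoint A \<in> carrier_mat m n"
  by (rule carrier_matI) auto

lemma mat_adjoint_mult:
  fixes A B :: "complex mat"
  assumes "A \<in> carrier_mat n m" "B \<in> carrier_mat m k"
  shows "mat_adjoint (A * B) = mat_adjoint B * mat_adjoint A"
  by (rule eq_matI) (use assms in \<open>auto simp: scalar_prod_def intro!: sum.cong\<close>)

lemma mat_adjoint_adjoint [simp]: "mat_adjoint (mat_adjoint (A :: complex mat)) = A"
  by (rule eq_matI) auto

lemma mat_adjoint_one [simp]: "mat_adjoint (1\<^sub>m n :: complex mat) = 1\<^sub>m n"
  by (rule eq_matI) auto

lemma mat_adjoint_four_block:
  fixes A :: "complex mat"
  assumes "A \<in> carrier_mat n1 m1" "B \<in> carrier_mat n1 m2"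
    "C \<in> carrier_mat n2 m1" "D \<in> carrier_mat n2 m2"
  shows "mat_adjoint (four_block_mat A B C D) =
    four_block_mat (mat_adjoint A) (mat_adjoint C) (mat_adjoint B) (mat_adjoint D)"
  by (rule eq_matI) (use assms in auto)

lemma mult_mat_vec_cscalar:
  fixes A :: "complex mat"
  assumes A: "A \<in> carrier_mat n m" and u: "u \<in> carrier_vec m" and v: "v \<in> carrier_vec n"
  shows "(A *\<^sub>v u) \<bullet>c v = u \<bullet>c (mat_adjoint A *\<^sub>v v)"
proof -
  have "(A *\<^sub>v u) \<bullet>c v = (\<Sum>i = 0..<n. \<Sum>j = 0..<m. A $$ (i, j) * u $ j * cnj (v $ i))"
    using assms by (simp add: scalar_prod_def sum_distrib_right)
  also have "\<dots> = (\<Sum>j = 0..<m. \<Sum>i = 0..<n. A $$ (i, j) * u $ j * cnj (v $ i))"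
    by (rule sum.swap)
  also have "\<dots> = u \<bullet>c (mat_adjoint A *\<^sub>v v)"
    using assms by (simp add: scalar_prod_def sum_distrib_left mult_ac)
  finally show ?thesis .
qed

lemma unitary_left_right:
  fixes U :: "complex mat"
  assumes "U \<in> carrier_mat n n" "mat_adjoint U * U = 1\<^sub>m n"
  shows "U * mat_adjoint U = 1\<^sub>m n"
  using mat_mult_left_right_inverse[OF mat_adjoint_carrier[OF assms(1)] assms(1)] assms by simp

text \<open>The real counterpart of the complex number \<open>v \<bullet>c v\<close>, because order
  bounds and real derivatives are taken of it.\<close>

definition norm2_vec :: "complex vec \<Rightarrow> real" where
  "norm2_vec v = (\<Sum>i<dim_vec v. (cmod (v $ i))\<^sup>2)"

lemma norm2_vec_cscalar: "v \<bullet>c v = of_real (norm2_vec v)"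
  by (simp add: norm2_vec_def scalar_prod_def complex_mult_cnj cmod_power2 atLeast0LessThan)

lemma norm2_vec_nonneg [simp]: "norm2_vec v \<ge> 0"
  by (simp add: norm2_vec_def sum_nonneg)

lemma norm2_vec_zero_iff: "norm2_vec v = 0 \<longleftrightarrow> v = 0\<^sub>v (dim_vec v)"
  by (auto simp: norm2_vec_def sum_nonneg_eq_0_iff vec_eq_iff)

lemma norm2_vec_smult: "norm2_vec (a \<cdot>\<^sub>v v) = (cmod a)\<^sup>2 * norm2_vec v"
  by (simp add: norm2_vec_def sum_distrib_left norm_mult power_mult_distrib)

lemma norm2_vec_add:
  assumes "u \<in> carrier_vec n" "v \<in> carrier_vec n"
  shows "norm2_vec (u + v) = norm2_vec u + 2 * Re (u \<bullet>c v) + norm2_vec v"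
proof -
  have "(cmod (a + b))\<^sup>2 = (cmod a)\<^sup>2 + 2 * Re (a * cnj b) + (cmod b)\<^sup>2" for a b
    by (simp add: cmod_power2) (simp add: algebra_simps power2_eq_square)
  then show ?thesis
    using assms by (simp add: norm2_vec_def scalar_prod_def sum.distrib sum_distrib_left atLeast0LessThan)
qed

text \<open>\<open>gram_schmidt\<close> keeps the head of the completed basis and returns
  orthogonal, nonzero, but not normalised vectors. Dividing each by its norm gives a unitary matrix
  whose first column is still a nonzero multiple of \<open>v\<close>, which is all that deflation
  requires.\<close>

lemma unitary_extension:
  fixes v :: "complex vec"
  assumes v: "v \<in> carrier_vec n" and v0: "v \<noteq> 0\<^sub>v n" and n: "n > 0"
  obtains W a where "W \<in> carrier_mat n n" "mat_adjoint W * W = 1\<^sub>m n" "a \<noteq> 0" "col W 0 = a \<cdot>\<^sub>v v"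
proof -
  define b where "b = basis_completion v"
  define ws where "ws = gram_schmidt n b"
  interpret cof_vec_space n "TYPE(complex)" .
  from basis_completion[OF v v0, folded b_def]
  have dist_b: "distinct b" and indep: "\<not> lin_dep (set b)" and b: "set b \<subseteq> carrier_vec n"
    and hdb: "hd b = v" and len_b: "length b = n" by auto
  from hdb len_b n obtain vs where bv: "b = v # vs" by (cases b, auto)
  from gram_schmidt_result[OF b dist_b indep refl, folded ws_def]
  have ws: "set ws \<subseteq> carrier_vec n" "corthogonal ws" "length ws = n"
    by (auto simp: len_b)
  from gram_schmidt_hd[OF v, of vs, folded bv] have "hd ws = v" unfolding ws_def .
  then have ws0: "ws ! 0 = v" using n ws by (metis hd_conv_nth list.size(3) not_less0)
  define r where "r = (\<lambda>i. 1 / sqrt (norm2_vec (ws ! i)))"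
  define W where "W = mat_of_cols n (map (\<lambda>i. of_real (r i) \<cdot>\<^sub>v ws ! i) [0..<n])"
  have wsc: "ws ! i \<in> carrier_vec n" if "i < n" for i using ws that by auto
  have pos: "norm2_vec (ws ! i) > 0" if "i < n" for i
  proof -
    have "ws ! i \<bullet>c ws ! i \<noteq> 0" using corthogonalD[OF ws(2), of i i] that ws(3) by simp
    then have "norm2_vec (ws ! i) \<noteq> 0" by (simp add: norm2_vec_cscalar)
    then show ?thesis using norm2_vec_nonneg[of "ws ! i"] by linarith
  qed
  have W: "W \<in> carrier_mat n n" by (simp add: W_def mat_of_cols_def)
  have colW: "col W i = of_real (r i) \<cdot>\<^sub>v ws ! i" if "i < n" for i
    using that wsc[OF that] by (simp add: W_def col_mat_of_cols)
  have "mat_adjoint W * W = 1\<^sub>m n"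
  proof (rule eq_matI)
    fix i j assume "i < dim_row (1\<^sub>m n :: complex mat)" "j < dim_col (1\<^sub>m n :: complex mat)"
    then have ij: "i < n" "j < n" by auto
    have "(mat_adjoint W * W) $$ (i, j) = col W j \<bullet>c col W i"
      using W ij by (simp add: scalar_prod_def mult_ac)
    also have "\<dots> = of_real (r i * r j) * (ws ! j \<bullet>c ws ! i)"
      using ij wsc[OF ij(1)] wsc[OF ij(2)] by (simp add: colW conjugate_smult_vec)
    also have "\<dots> = (if i = j then 1 else 0)"
    proof (cases "i = j")
      case True
      have "r i * r i * norm2_vec (ws ! i) = 1"
        using pos[OF ij(1)] by (simp add: r_def real_sqrt_mult_self)
      then show ?thesis using True by (simp add: norm2_vec_cscalar flip: of_real_mult)
    next
      case False
      then show ?thesis using corthogonalD[OF ws(2), of j i] ij ws(3) by simp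
    qed
    finally show "(mat_adjoint W * W) $$ (i, j) = (1\<^sub>m n) $$ (i, j)" using ij by simp
  qed (use W in auto)
  moreover have "r 0 \<noteq> 0" using pos[OF n] by (simp add: r_def)
  ultimately show thesis using that[OF W, of "of_real (r 0)"] colW[OF n] ws0 by auto
qed

lemma assoc_mult_mat5:
  fixes A B C D E :: "'a::semiring_0 mat"
  assumes A: "A \<in> carrier_mat n n" and B: "B \<in> carrier_mat n n" and C: "C \<in> carrier_mat n n"
    and D: "D \<in> carrier_mat n n" and E: "E \<in> carrier_mat n n"
  shows "A * B * C * (D * E) = A * (B * C * D) * E"
proof -
  note AB = mult_carrier_mat[OF A B] and BC = mult_carrier_mat[OF B C]
  have "A * B * C * (D * E) = A * B * C * D * E"
    by (rule assoc_mult_mat[symmetric, OF mult_carrier_mat[OF AB C] D E])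
  also have "A * B * C * D = A * (B * C) * D" by (simp only: assoc_mult_mat[OF A B C])
  also have "\<dots> = A * (B * C * D)" by (rule assoc_mult_mat[OF A BC D])
  finally show ?thesis .
qed

text \<open>Deflation: in an orthonormal basis that starts with an eigenvector, the first column has
  a single nonzero entry, by symmetry so does the first row, and the remaining block is again
  Hermitian.\<close>

lemma hermitian_unitary_diagonalization:
  fixes A :: "complex mat"
  assumes "A \<in> carrier_mat n n" "mat_adjoint A = A"
  shows "\<exists>U d. U \<in> carrier_mat n n \<and> mat_adjoint U * U = 1\<^sub>m n \<and>
    mat_adjoint U * A * U = mat_diag n (\<lambda>i. complex_of_real (d i))"
  using assms
proof (induction n arbitrary: A)
  case 0
  then have "mat_adjoint (1\<^sub>m 0) * A * 1\<^sub>m 0 = mat_diag 0 (\<lambda>i. complex_of_real 0)"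
    by (intro eq_matI) (auto simp: mat_diag_def)
  then show ?case by (intro exI[of _ "1\<^sub>m 0"] exI[of _ "\<lambda>_. 0"]) simp
next
  case (Suc n A)
  note A = Suc.prems(1) and herm = Suc.prems(2)
  obtain e v where v: "v \<in> carrier_vec (Suc n)" "v \<noteq> 0\<^sub>v (Suc n)" and ev: "A *\<^sub>v v = e \<cdot>\<^sub>v v"
  proof -
    from char_poly_factorized[OF A] obtain as
      where as: "char_poly A = (\<Prod>a\<leftarrow>as. [:- a, 1:])" "length as = Suc n" by auto
    then obtain e bs where "as = e # bs" by (cases as) auto
    then have "eigenvalue A e" using as by (simp add: eigenvalue_root_char_poly[OF A])
    then show thesis using that A by (auto simp: eigenvalue_def eigenvector_def)
  qed
  obtain W a where W: "W \<in> carrier_mat (Suc n) (Suc n)" and WW: "mat_adjoint W * W = 1\<^sub>m (Suc n)"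
    and a: "a \<noteq> 0" and col0: "col W 0 = a \<cdot>\<^sub>v v"
    using unitary_extension[OF v] by auto
  have W': "mat_adjoint W \<in> carrier_mat (Suc n) (Suc n)" using W by simp
  define H where "H = mat_adjoint W * A * W"
  have H: "H \<in> carrier_mat (Suc n) (Suc n)" using W W' A by (simp add: H_def mult_carrier_mat[of _ "Suc n" "Suc n" _ "Suc n"])
  have Hherm: "mat_adjoint H = H"
    using W A W' herm by (simp add: H_def mat_adjoint_mult[of _ "Suc n" "Suc n" _ "Suc n"]
      assoc_mult_mat[of _ "Suc n" "Suc n" _ "Suc n" _ "Suc n"])
  \<comment> \<open>\<open>col W 0\<close> is an eigenvector, so column 0 of \<open>H\<close> is
    \<open>e\<close> times column 0 of \<open>mat_adjoint W * W\<close>, the identity.\<close>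
  have Hcol: "H $$ (i, 0) = (if i = 0 then e else 0)" if i: "i < Suc n" for i
  proof -
    have "H = mat_adjoint W * (A * W)" unfolding H_def by (rule assoc_mult_mat[OF W' A W])
    then have "H $$ (i, 0) = row (mat_adjoint W) i \<bullet> col (A * W) 0"
      using i W A by (simp only: index_mult_mat carrier_matD mat_adjoint_dim zero_less_Suc)
    also have "\<dots> = (mat_adjoint W *\<^sub>v (A *\<^sub>v col W 0)) $ i"
      using i W by (simp only: col_mult2[OF A W zero_less_Suc] index_mult_mat_vec carrier_matD mat_adjoint_dim)
    also have "A *\<^sub>v col W 0 = e \<cdot>\<^sub>v col W 0"
      using A v ev by (simp add: col0 mult_mat_vec smult_smult_assoc mult.commute)
    also have "(mat_adjoint W *\<^sub>v (e \<cdot>\<^sub>v col W 0)) $ i = e * (mat_adjoint W * W) $$ (i, 0)"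
      using i W by simp
    finally show ?thesis using i by (simp add: WW)
  qed
  have Hrow: "H $$ (0, i) = (if i = 0 then e else 0)" if i: "i < Suc n" for i
    using arg_cong[OF Hherm, of "\<lambda>M. M $$ (0, i)"] Hcol[OF i] i H
      arg_cong[OF Hherm, of "\<lambda>M. M $$ (0, 0)"] Hcol[of 0]
    by (auto split: if_splits)
  have e: "e = of_real (Re e)"
    using arg_cong[OF Hherm, of "\<lambda>M. M $$ (0, 0)"] Hcol[of 0] H by (simp add: complex_eq_iff)
  define H3 where "H3 = mat n n (\<lambda>(i, j). H $$ (Suc i, Suc j))"
  have H3: "H3 \<in> carrier_mat n n" by (simp add: H3_def)
  have Hblock: "H = four_block_mat (mat 1 1 (\<lambda>_. e)) (0\<^sub>m 1 n) (0\<^sub>m n 1) H3"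
    using H by (intro eq_matI) (auto simp: H3_def Hrow Hcol gr0_conv_Suc)
  have "mat_adjoint H3 = H3"
  proof (rule eq_matI)
    fix i j assume "i < dim_row H3" "j < dim_col H3"
    then show "mat_adjoint H3 $$ (i, j) = H3 $$ (i, j)"
      using arg_cong[OF Hherm, of "\<lambda>M. M $$ (Suc i, Suc j)"] H by (simp add: H3_def)
  qed (simp_all add: H3_def)
  from Suc.IH[OF H3 this] obtain U d where U: "U \<in> carrier_mat n n" and UU: "mat_adjoint U * U = 1\<^sub>m n"
    and Ud: "mat_adjoint U * H3 * U = mat_diag n (\<lambda>i. complex_of_real (d i))" by auto
  define P where "P = four_block_mat (1\<^sub>m 1) (0\<^sub>m 1 n) (0\<^sub>m n 1) U"
  have P: "P \<in> carrier_mat (Suc n) (Suc n)"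
    using four_block_carrier_mat[OF one_carrier_mat[of 1] U] by (simp add: P_def)
  have P': "mat_adjoint P = four_block_mat (1\<^sub>m 1) (0\<^sub>m 1 n) (0\<^sub>m n 1) (mat_adjoint U)"
  proof -
    have "mat_adjoint (0\<^sub>m k l :: complex mat) = 0\<^sub>m l k" for k l by (rule eq_matI) auto
    then show ?thesis unfolding P_def by (subst mat_adjoint_four_block[of _ 1 1 _ n _ n]) (use U in auto)
  qed
  have P'c: "mat_adjoint P \<in> carrier_mat (Suc n) (Suc n)" using P by simp
  have PP: "mat_adjoint P * P = 1\<^sub>m (Suc n)"
    unfolding P' unfolding P_def
    by (subst mult_four_block_mat[of _ 1 1 _ n _ n _ _ 1 _ n])
      (use U UU in \<open>auto intro!: eq_matI\<close>)
  have PH: "mat_adjoint P * H = four_block_mat (mat 1 1 (\<lambda>_. e)) (0\<^sub>m 1 n) (0\<^sub>m n 1) (mat_adjoint U * H3)"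
    unfolding P' Hblock
    by (subst mult_four_block_mat[of _ 1 1 _ n _ n _ _ 1 _ n]) (use U H3 in auto)
  have PHP: "mat_adjoint P * H * P = four_block_mat (mat 1 1 (\<lambda>_. e)) (0\<^sub>m 1 n) (0\<^sub>m n 1) (mat_adjoint U * H3 * U)"
    unfolding PH unfolding P_def
    by (subst mult_four_block_mat[of _ 1 1 _ n _ n _ _ 1 _ n]) (use U H3 in auto)
  define Q where "Q = W * P"
  have Q: "Q \<in> carrier_mat (Suc n) (Suc n)" using W P by (simp add: Q_def)
  have Q': "mat_adjoint Q = mat_adjoint P * mat_adjoint W"
    unfolding Q_def using mat_adjoint_mult[OF W P] .
  note assoc = assoc_mult_mat[of _ "Suc n" "Suc n" _ "Suc n" _ "Suc n"]
  have "mat_adjoint Q * Q = mat_adjoint P * (mat_adjoint W * W) * P"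
    unfolding Q' unfolding Q_def using P W P'c W' by (simp add: assoc mult_carrier_mat[of _ "Suc n" "Suc n" _ "Suc n"])
  then have QQ: "mat_adjoint Q * Q = 1\<^sub>m (Suc n)" unfolding WW right_mult_one_mat[OF P'c] PP .
  have "mat_adjoint Q * A * Q = mat_adjoint P * H * P"
    unfolding Q' H_def unfolding Q_def by (rule assoc_mult_mat5[OF P'c W' A W P])
  also have "\<dots> = mat_diag (Suc n) (\<lambda>i. complex_of_real (case i of 0 \<Rightarrow> Re e | Suc k \<Rightarrow> d k))"
    unfolding PHP Ud using e by (intro eq_matI) (auto simp: mat_diag_def gr0_conv_Suc split: nat.splits)
  finally show ?case using Q QQ by blast
qed

text \<open>Links the definition by roots of the characteristic polynomial to an eigenbasis.
  Similarity preserves that polynomial, and for a diagonal matrix it splits into the factors with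
  roots \<open>d i\<close>, so multiplicities in \<open>singular_values M\<close> count indices
  \<open>i\<close>.\<close>

lemma gram_spectral:
  fixes M :: "complex mat"
  assumes M: "M \<in> carrier_mat n n"
  obtains U d where "U \<in> carrier_mat n n" "mat_adjoint U * U = 1\<^sub>m n" "U * mat_adjoint U = 1\<^sub>m n"
    "mat_adjoint M * M = U * mat_diag n (\<lambda>i. complex_of_real (d i)) * mat_adjoint U"
    "mset (singular_values M) = image_mset (\<lambda>i. sqrt (d i)) (mset [0..<n])"
proof -
  define A where "A = mat_adjoint M * M"
  have A: "A \<in> carrier_mat n n" unfolding A_def using mult_carrier_mat[OF mat_adjoint_carrier[OF M] M] .
  have "mat_adjoint A = A" using M by (simp add: A_def mat_adjoint_mult[of _ n n _ n])
  from hermitian_unitary_diagonalization[OF A this] obtain U d where U: "U \<in> carrier_mat n n"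
    and UU: "mat_adjoint U * U = 1\<^sub>m n"
    and D: "mat_adjoint U * A * U = mat_diag n (\<lambda>i. complex_of_real (d i))" by auto
  have UU': "U * mat_adjoint U = 1\<^sub>m n" by (rule unitary_left_right[OF U UU])
  have U': "mat_adjoint U \<in> carrier_mat n n" using U by simp
  let ?D = "mat_diag n (\<lambda>i. complex_of_real (d i))"
  have Dc: "?D \<in> carrier_mat n n" by simp
  have "U * ?D * mat_adjoint U = (U * mat_adjoint U) * A * (U * mat_adjoint U)"
    unfolding D[symmetric] assoc_mult_mat5[OF U U' A U U'] ..
  then have AD: "A = U * ?D * mat_adjoint U" using UU' A by simp
  have "similar_mat A ?D"
    unfolding similar_mat_def similar_mat_wit_def Let_def
    using A U U' UU UU' AD Dc by (intro exI[of _ U] exI[of _ "mat_adjoint U"]) auto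
  then have "char_poly A = char_poly ?D" by (rule char_poly_similar)
  also have "\<dots> = (\<Prod>a\<leftarrow>diag_mat ?D. [:- a, 1:])"
    by (rule char_poly_upper_triangular[OF Dc]) (auto simp: mat_diag_def upper_triangular_def)
  also have "diag_mat ?D = map (\<lambda>i. of_real (d i)) [0..<n]"
    by (auto simp: diag_mat_def mat_diag_def)
  finally have "proots (char_poly A) = image_mset (\<lambda>i. complex_of_real (d i)) (mset [0..<n])"
  proof -
    have pr: "proots (\<Prod>a\<leftarrow>xs. [:- a, 1:]) = mset xs" for xs :: "complex list"
    proof (induction xs)
      case (Cons a xs)
      have "(\<Prod>a\<leftarrow>xs. [:- a, 1:]) \<noteq> 0" by (auto simp: prod_list_zero_iff)
      then show ?case using Cons proots_mult[of "[:- a, 1:]"] by simp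
    qed simp
    show "proots (char_poly A) = image_mset (\<lambda>i. complex_of_real (d i)) (mset [0..<n])"
      if "char_poly A = (\<Prod>a\<leftarrow>map (\<lambda>i. complex_of_real (d i)) [0..<n]. [:- a, 1:])"
      unfolding that pr by (rule mset_map)
  qed
  then have "mset (singular_values M) = image_mset (\<lambda>i. sqrt (d i)) (mset [0..<n])"
    by (simp add: singular_values_def A_def[symmetric] image_mset.compositionality o_def)
  with that U UU UU' AD show thesis unfolding A_def by blast
qed

section \<open>Variational characterization of the largest singular value\<close>

lemma norm2_vec_mult_mat:
  fixes M :: "complex mat"
  assumes M: "M \<in> carrier_mat n n" and v: "v \<in> carrier_vec n"
  shows "of_real (norm2_vec (M *\<^sub>v v)) = v \<bullet>c ((mat_adjoint M * M) *\<^sub>v v)"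
proof -
  have "of_real (norm2_vec (M *\<^sub>v v)) = (M *\<^sub>v v) \<bullet>c (M *\<^sub>v v)"
    by (simp add: norm2_vec_cscalar)
  also have "\<dots> = v \<bullet>c (mat_adjoint M *\<^sub>v (M *\<^sub>v v))"
    by (rule mult_mat_vec_cscalar[OF M v]) (use M v in auto)
  finally show ?thesis
    using assoc_mult_mat_vec[OF mat_adjoint_carrier[OF M] M v] by simp
qed

text \<open>The coordinates \<open>a v\<close> of \<open>v\<close> in an orthonormal eigenbasis of \<open>M\<^sup>H M\<close> diagonalize
  the quadratic form \<open>v \<mapsto> \<parallel>M v\<parallel>\<^sup>2\<close>.\<close>

lemma sigma_max_coordinates:
  fixes M :: "complex mat"
  assumes M: "M \<in> carrier_mat n n" and n: "n > 0"
  obtains a :: "complex vec \<Rightarrow> nat \<Rightarrow> complex" and d :: "nat \<Rightarrow> real" and e :: "nat \<Rightarrow> complex vec" where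
    "\<And>v. v \<in> carrier_vec n \<Longrightarrow> norm2_vec v = (\<Sum>i<n. (cmod (a v i))\<^sup>2)"
    "\<And>v. v \<in> carrier_vec n \<Longrightarrow> norm2_vec (M *\<^sub>v v) = (\<Sum>i<n. d i * (cmod (a v i))\<^sup>2)"
    "\<And>u v. u \<in> carrier_vec n \<Longrightarrow> v \<in> carrier_vec n \<Longrightarrow> u \<bullet>c v = (\<Sum>i<n. a u i * cnj (a v i))"
    "\<And>v i. v \<in> carrier_vec n \<Longrightarrow> i < n \<Longrightarrow> a ((mat_adjoint M * M) *\<^sub>v v) i = of_real (d i) * a v i"
    "\<And>i. i < n \<Longrightarrow> e i \<in> carrier_vec n"
    "\<And>i j. i < n \<Longrightarrow> j < n \<Longrightarrow> a (e i) j = (if i = j then 1 else 0)"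
    "\<And>i. i < n \<Longrightarrow> d i \<le> (sigma_max M)\<^sup>2"
    "sigma_max M \<ge> 0"
    "\<exists>m<n. d m = (sigma_max M)\<^sup>2"
    "\<And>i m. sigma_max_simple M \<Longrightarrow> i < n \<Longrightarrow> m < n \<Longrightarrow> d i = (sigma_max M)\<^sup>2 \<Longrightarrow>
       d m = (sigma_max M)\<^sup>2 \<Longrightarrow> i = m"
proof -
  obtain U d where U: "U \<in> carrier_mat n n" and UU: "mat_adjoint U * U = 1\<^sub>m n"
    and UU': "U * mat_adjoint U = 1\<^sub>m n"
    and B: "mat_adjoint M * M = U * mat_diag n (\<lambda>i. complex_of_real (d i)) * mat_adjoint U"
    and sv: "mset (singular_values M) = image_mset (\<lambda>i. sqrt (d i)) (mset [0..<n])"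
    using gram_spectral[OF M] by metis
  let ?D = "mat_diag n (\<lambda>i. complex_of_real (d i))"
  define a where "a = (\<lambda>v i. (mat_adjoint U *\<^sub>v v) $ i)"
  have U': "mat_adjoint U \<in> carrier_mat n n" using U by simp
  have Dc: "?D \<in> carrier_mat n n" by simp
  have Uv: "mat_adjoint U *\<^sub>v v \<in> carrier_vec n" if "v \<in> carrier_vec n" for v
    using U' that by simp
  have cs: "u \<bullet>c v = (\<Sum>i<n. a u i * cnj (a v i))"
    if u: "u \<in> carrier_vec n" and v: "v \<in> carrier_vec n" for u v
  proof -
    have "(mat_adjoint U *\<^sub>v u) \<bullet>c (mat_adjoint U *\<^sub>v v) = u \<bullet>c ((U * mat_adjoint U) *\<^sub>v v)"
      using mult_mat_vec_cscalar[OF U' u Uv[OF v]] U U' v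
      by (simp add: assoc_mult_mat_vec[of _ n n _ n])
    then have "u \<bullet>c v = (mat_adjoint U *\<^sub>v u) \<bullet>c (mat_adjoint U *\<^sub>v v)"
      using UU' v by simp
    then show ?thesis using U by (simp add: scalar_prod_def a_def atLeast0LessThan)
  qed
  have nv: "norm2_vec v = (\<Sum>i<n. (cmod (a v i))\<^sup>2)" if v: "v \<in> carrier_vec n" for v
  proof -
    have "complex_of_real (norm2_vec v) = of_real (\<Sum>i<n. (cmod (a v i))\<^sup>2)"
      by (simp add: norm2_vec_cscalar[symmetric] cs[OF v v] complex_mult_cnj cmod_power2)
    then show ?thesis by (simp only: of_real_eq_iff)
  qed
  have Dv: "(?D *\<^sub>v v) $ i = of_real (d i) * v $ i" if "v \<in> carrier_vec n" "i < n" for v i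
    using that by (simp add: mat_diag_def scalar_prod_def if_distrib[of "\<lambda>x. x * _"] cong: if_cong)
  have ad: "a ((mat_adjoint M * M) *\<^sub>v v) i = of_real (d i) * a v i"
    if v: "v \<in> carrier_vec n" and i: "i < n" for v i
  proof -
    have "mat_adjoint U *\<^sub>v ((mat_adjoint M * M) *\<^sub>v v) =
        (mat_adjoint U * U) *\<^sub>v (?D *\<^sub>v (mat_adjoint U *\<^sub>v v))"
      unfolding B using U U' Dc v Uv[OF v]
        assoc_mult_mat_vec[OF mult_carrier_mat[OF U Dc] U' v]
        assoc_mult_mat_vec[OF U Dc Uv[OF v]]
        assoc_mult_mat_vec[OF U' U mult_mat_vec_carrier[OF Dc Uv[OF v]]]
      by metis
    also have "\<dots> = ?D *\<^sub>v (mat_adjoint U *\<^sub>v v)"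
      unfolding UU by (rule one_mult_mat_vec) (use Dc Uv[OF v] in \<open>simp add: mult_mat_vec_carrier[of _ n n]\<close>)
    finally show ?thesis by (simp only: a_def Dv[OF Uv[OF v] i])
  qed
  have nMv: "norm2_vec (M *\<^sub>v v) = (\<Sum>i<n. d i * (cmod (a v i))\<^sup>2)" if v: "v \<in> carrier_vec n" for v
  proof -
    have B_v: "(mat_adjoint M * M) *\<^sub>v v \<in> carrier_vec n"
      using mult_carrier_mat[OF mat_adjoint_carrier[OF M] M] v by simp
    have "complex_of_real (norm2_vec (M *\<^sub>v v)) = (\<Sum>i<n. a v i * cnj (of_real (d i) * a v i))"
      using cs[OF v B_v] by (simp add: norm2_vec_mult_mat[OF M v] ad[OF v])
    also have "\<dots> = of_real (\<Sum>i<n. d i * (cmod (a v i))\<^sup>2)"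
      by (simp add: mult.left_commute[of "a v _"] complex_mult_cnj cmod_power2)
    finally show ?thesis by (simp only: of_real_eq_iff)
  qed
  define e where "e = (\<lambda>i. U *\<^sub>v unit_vec n i)"
  have ec: "e i \<in> carrier_vec n" for i using U by (simp add: e_def)
  have ae: "a (e i) j = (if i = j then 1 else 0)" if "i < n" "j < n" for i j
  proof -
    have "mat_adjoint U *\<^sub>v e i = (mat_adjoint U * U) *\<^sub>v unit_vec n i"
      unfolding e_def using U U' by (simp add: assoc_mult_mat_vec[of _ n n _ n])
    then show ?thesis using UU that by (simp add: a_def)
  qed
  \<comment> \<open>\<open>d i\<close> is the squared norm of \<open>M\<close> applied to the
    \<open>i\<close>-th eigenvector; nonnegativity allows \<open>sqrt (d i)\<close> to be squared
    back.\<close>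
  have d0: "d i \<ge> 0" if "i < n" for i
  proof -
    have "norm2_vec (M *\<^sub>v e i) = (\<Sum>j<n. if i = j then d j else 0)"
      unfolding nMv[OF ec] by (rule sum.cong) (use ae that in auto)
    then show ?thesis using norm2_vec_nonneg[of "M *\<^sub>v e i"] that by simp
  qed
  define xs where "xs = singular_values M"
  have ms: "mset xs = mset (map (\<lambda>i. sqrt (d i)) [0..<n])" using sv by (simp add: xs_def)
  then have len: "length xs = n" using mset_eq_length by fastforce
  have set_xs: "set xs = (\<lambda>i. sqrt (d i)) ` {..<n}"
    using mset_eq_setD[OF ms] by (simp add: atLeast0LessThan)
  have desc: "sorted_wrt (\<ge>) xs"
    unfolding xs_def singular_values_def by (simp add: sorted_wrt_rev)
  have s0: "sigma_max M = xs ! 0" by (simp add: sigma_max_def xs_def)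
  have le0: "y \<le> xs ! 0" if "y \<in> set xs" for y
    using that desc len by (cases xs) auto
  have "xs ! 0 \<in> set xs" using len n by simp
  then obtain m where m: "m < n" "xs ! 0 = sqrt (d m)" using set_xs by auto
  have sig0: "sigma_max M \<ge> 0" using m d0 s0 by simp
  have dm: "d m = (sigma_max M)\<^sup>2" using m d0[of m] s0 by simp
  have dle: "d i \<le> (sigma_max M)\<^sup>2" if "i < n" for i
    by (rule sqrt_le_D) (use le0 set_xs that s0 in auto)
  \<comment> \<open>Simplicity makes the head of the decreasing list occur in it once, whereas two
    distinct indices with the maximal \<open>d\<close> would make it occur at least twice.\<close>
  have uniq: "i = k" if simp: "sigma_max_simple M" and ik: "i < n" "k < n"
    and "d i = (sigma_max M)\<^sup>2" "d k = (sigma_max M)\<^sup>2" for i k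
  proof (rule ccontr)
    assume ne: "i \<noteq> k"
    have sq: "sqrt (d i) = xs ! 0" "sqrt (d k) = xs ! 0" using that sig0 s0 by auto
    obtain x y ys where xs: "xs = x # y # ys"
      using len ik ne by (cases xs; cases "tl xs") auto
    have "y < x" using simp xs by (simp add: sigma_max_simple_def xs_def[symmetric])
    then have "\<forall>z\<in>set (y # ys). z < x" using desc xs by auto
    then have "count_list ys x = 0" "y \<noteq> x" by (auto intro!: count_notin)
    then have "count (mset xs) x = 1"
      by (simp add: xs count_mset)
    moreover have "count (mset xs) x = card {j. j < n \<and> x = sqrt (d j)}"
      unfolding ms count_mset count_list_eq_length_filter length_filter_conv_card
      by (rule arg_cong[of _ _ card]) auto
    moreover have "card {i, k} \<le> card {j. j < n \<and> x = sqrt (d j)}"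
      by (rule card_mono) (use sq ik xs in auto)
    ultimately show False using ne by simp
  qed
  show thesis
    using that[of a d e] nv nMv cs ad ec ae dle sig0 dm m(1) uniq by blast
qed

lemma sigma_max_nonneg:
  assumes "M \<in> carrier_mat n n" "n > 0"
  shows "sigma_max M \<ge> 0"
  using sigma_max_coordinates[OF assms] by metis

lemma norm2_mult_le_sigma_max:
  assumes M: "M \<in> carrier_mat n n" "n > 0" and v: "v \<in> carrier_vec n"
  shows "norm2_vec (M *\<^sub>v v) \<le> (sigma_max M)\<^sup>2 * norm2_vec v"
proof -
  obtain a :: "complex vec \<Rightarrow> nat \<Rightarrow> complex" and d where
    1: "\<And>v. v \<in> carrier_vec n \<Longrightarrow> norm2_vec v = (\<Sum>i<n. (cmod (a v i))\<^sup>2)"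
    and 2: "\<And>v. v \<in> carrier_vec n \<Longrightarrow> norm2_vec (M *\<^sub>v v) = (\<Sum>i<n. d i * (cmod (a v i))\<^sup>2)"
    and 3: "\<And>i. i < n \<Longrightarrow> d i \<le> (sigma_max M)\<^sup>2"
    by (rule sigma_max_coordinates[OF M]) blast
  show ?thesis
    unfolding 1[OF v] 2[OF v] sum_distrib_left by (rule sum_mono) (use 3 in \<open>auto intro: mult_right_mono\<close>)
qed

lemma sigma_max_attained:
  assumes M: "M \<in> carrier_mat n n" "n > 0"
  obtains v where "v \<in> carrier_vec n" "norm2_vec v = 1" "norm2_vec (M *\<^sub>v v) = (sigma_max M)\<^sup>2"
proof -
  obtain a :: "complex vec \<Rightarrow> nat \<Rightarrow> complex" and d e where
    1: "\<And>v. v \<in> carrier_vec n \<Longrightarrow> norm2_vec v = (\<Sum>i<n. (cmod (a v i))\<^sup>2)"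
    and 2: "\<And>v. v \<in> carrier_vec n \<Longrightarrow> norm2_vec (M *\<^sub>v v) = (\<Sum>i<n. d i * (cmod (a v i))\<^sup>2)"
    and 3: "\<And>i. i < n \<Longrightarrow> e i \<in> carrier_vec n"
    and 4: "\<And>i j. i < n \<Longrightarrow> j < n \<Longrightarrow> a (e i) j = (if i = j then 1 else 0)"
    and 5: "\<exists>m<n. d m = (sigma_max M)\<^sup>2"
    by (rule sigma_max_coordinates[OF M]) blast
  obtain m where m: "m < n" "d m = (sigma_max M)\<^sup>2" using 5 by blast
  have "norm2_vec (e m) = (\<Sum>j<n. if m = j then 1 else 0)"
    unfolding 1[OF 3[OF m(1)]] by (rule sum.cong) (use 4 m in auto)
  moreover have "norm2_vec (M *\<^sub>v e m) = (\<Sum>j<n. if m = j then d j else 0)"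
    unfolding 2[OF 3[OF m(1)]] by (rule sum.cong) (use 4 m in auto)
  ultimately show thesis using that[OF 3[OF m(1)]] m by simp
qed

text \<open>Simplicity leaves one index \<open>m\<close> with the maximal \<open>d\<close>. The
  eigenvector \<open>v\<close> has only the coordinate \<open>m\<close>, so a vector orthogonal to
  \<open>v\<close> lacks exactly this coordinate and sees only the smaller values of
  \<open>d\<close>.\<close>

lemma sigma_max_gap:
  assumes M: "M \<in> carrier_mat n n" "n > 0" and simp: "sigma_max_simple M"
    and v: "v \<in> carrier_vec n" "v \<noteq> 0\<^sub>v n"
    and ev: "(mat_adjoint M * M) *\<^sub>v v = of_real ((sigma_max M)\<^sup>2) \<cdot>\<^sub>v v"
  obtains \<mu> where "\<mu> < (sigma_max M)\<^sup>2"
    "\<And>y. y \<in> carrier_vec n \<Longrightarrow> y \<bullet>c v = 0 \<Longrightarrow> norm2_vec (M *\<^sub>v y) \<le> \<mu> * norm2_vec y"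
proof -
  obtain a :: "complex vec \<Rightarrow> nat \<Rightarrow> complex" and d e where
    1: "\<And>v. v \<in> carrier_vec n \<Longrightarrow> norm2_vec v = (\<Sum>i<n. (cmod (a v i))\<^sup>2)"
    and 2: "\<And>v. v \<in> carrier_vec n \<Longrightarrow> norm2_vec (M *\<^sub>v v) = (\<Sum>i<n. d i * (cmod (a v i))\<^sup>2)"
    and 3: "\<And>u v. u \<in> carrier_vec n \<Longrightarrow> v \<in> carrier_vec n \<Longrightarrow> u \<bullet>c v = (\<Sum>i<n. a u i * cnj (a v i))"
    and 4: "\<And>v i. v \<in> carrier_vec n \<Longrightarrow> i < n \<Longrightarrow> a ((mat_adjoint M * M) *\<^sub>v v) i = of_real (d i) * a v i"
    and 8: "\<And>i. i < n \<Longrightarrow> e i \<in> carrier_vec n"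
    and 9: "\<And>i j. i < n \<Longrightarrow> j < n \<Longrightarrow> a (e i) j = (if i = j then 1 else 0)"
    and 5: "\<exists>m<n. d m = (sigma_max M)\<^sup>2"
    and 6: "\<And>i. i < n \<Longrightarrow> d i \<le> (sigma_max M)\<^sup>2"
    and 7: "\<And>i m. sigma_max_simple M \<Longrightarrow> i < n \<Longrightarrow> m < n \<Longrightarrow> d i = (sigma_max M)\<^sup>2 \<Longrightarrow> d m = (sigma_max M)\<^sup>2 \<Longrightarrow> i = m"
    by (rule sigma_max_coordinates[OF M]) blast
  obtain m where m: "m < n" "d m = (sigma_max M)\<^sup>2" using 5 by blast
  have lt: "d i < (sigma_max M)\<^sup>2" if "i < n" "i \<noteq> m" for i
    using 6[of i] 7[OF simp, of i m] m that by fastforce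
  \<comment> \<open>The coordinates become inner products, which gives access to their linearity;
    the scalar in the eigenvector equation \<open>ev\<close> can then be pulled out.\<close>
  have coord: "u \<bullet>c e i = a u i" if "u \<in> carrier_vec n" "i < n" for u i
  proof -
    have "u \<bullet>c e i = (\<Sum>j<n. if i = j then a u j else 0)"
      unfolding 3[OF that(1) 8[OF that(2)]] by (rule sum.cong) (use 9 that in auto)
    then show ?thesis using that by simp
  qed
  have v0: "a v i = 0" if "i < n" "i \<noteq> m" for i
  proof -
    have "of_real (d i) * a v i = of_real ((sigma_max M)\<^sup>2) * a v i"
      using 4[OF v(1) that(1)] coord[OF v(1) that(1)] v(1) that(1)
        coord[of "of_real ((sigma_max M)\<^sup>2) \<cdot>\<^sub>v v" i] 8[OF that(1)]
      unfolding ev by auto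
    then show ?thesis using lt[OF that] by (simp flip: of_real_power)
  qed
  have vm: "a v m \<noteq> 0"
  proof
    assume "a v m = 0"
    then have "norm2_vec v = 0" unfolding 1[OF v(1)] by (intro sum.neutral) (use v0 in force)
    then show False using v by (simp add: norm2_vec_zero_iff)
  qed
  \<comment> \<open>The inserted value keeps the set nonempty when \<open>n = 1\<close>, and lies
    strictly below the maximum as well.\<close>
  define \<mu> where "\<mu> = Max (insert ((sigma_max M)\<^sup>2 - 1) (d ` ({..<n} - {m})))"
  show thesis
  proof (rule that)
    show "\<mu> < (sigma_max M)\<^sup>2" using lt by (auto simp: \<mu>_def)
    fix y assume y: "y \<in> carrier_vec n" "y \<bullet>c v = 0"
    have "(\<Sum>i<n. a y i * cnj (a v i)) = (\<Sum>i<n. if i = m then a y i * cnj (a v i) else 0)"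
      by (rule sum.cong) (auto simp: v0)
    then have ym: "a y m = 0" using y 3[OF y(1) v(1)] m vm by simp
    show "norm2_vec (M *\<^sub>v y) \<le> \<mu> * norm2_vec y"
      unfolding 1[OF y(1)] 2[OF y(1)] sum_distrib_left
    proof (rule sum_mono)
      fix i assume "i \<in> {..<n}"
      then show "d i * (cmod (a y i))\<^sup>2 \<le> \<mu> * (cmod (a y i))\<^sup>2"
        using ym by (cases "i = m") (auto simp: \<mu>_def intro!: mult_right_mono Max_ge)
    qed
  qed
qed

section \<open>Derivative of a simple largest singular value\<close>

lemma DERIV_zero_if_quadratic_bound:
  fixes f :: "real \<Rightarrow> real"
  assumes "eventually (\<lambda>x. \<bar>f x\<bar> \<le> C * (x - x0)\<^sup>2) (at x0)" "f x0 = 0"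
  shows "(f has_real_derivative 0) (at x0)"
  unfolding has_field_derivative_iff
proof (rule tendsto_0_le)
  show "\<forall>\<^sub>F x in at x0. norm ((f x - f x0) / (x - x0)) \<le> norm (x - x0) * C"
    using assms(1) eventually_neq_at_within[of x0 x0 UNIV]
  proof eventually_elim
    case (elim x)
    then have "\<bar>f x\<bar> \<le> \<bar>x - x0\<bar> * C * \<bar>x - x0\<bar>" "\<bar>x - x0\<bar> > 0"
      by (auto simp: power2_eq_square mult_ac simp flip: abs_mult)
    then show ?case using assms(2) by (simp add: divide_le_eq)
  qed
  show "((\<lambda>x. x - x0) \<longlongrightarrow> 0) (at x0)" by (simp add: LIM_zero)
qed

lemma has_vector_derivative_unique:
  assumes "(f has_vector_derivative a) (at x)" "(f has_vector_derivative b) (at x)"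
  shows "a = b"
proof -
  have "(\<lambda>h. h *\<^sub>R a) = (\<lambda>h. h *\<^sub>R b)"
    using has_derivative_unique assms unfolding has_vector_derivative_def by blast
  from fun_cong[OF this, of 1] show ?thesis by simp
qed

text \<open>Close to \<open>x0\<close> the remainder is at most \<open>\<bar>x - x0\<bar>\<close>,
  which accounts for the summand 1. Applied to the entries of the Gram matrix, this makes the
  perturbation linear in \<open>\<bar>x - x0\<bar>\<close>.\<close>

lemma has_vector_derivative_imp_Lipschitz_at:
  fixes f :: "real \<Rightarrow> complex"
  assumes "(f has_vector_derivative D) (at x0)"
  shows "eventually (\<lambda>x. cmod (f x - f x0) \<le> (cmod D + 1) * \<bar>x - x0\<bar>) (at x0)"
proof -
  have "((\<lambda>h. norm (f (x0 + h) - f x0 - h *\<^sub>R D) / norm h) \<longlongrightarrow> 0) (at 0)"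
    using assms unfolding has_vector_derivative_def has_derivative_at by simp
  then have "\<forall>\<^sub>F h in at 0. norm (f (x0 + h) - f x0 - h *\<^sub>R D) / norm h < 1"
    by (rule order_tendstoD) simp
  then have "\<forall>\<^sub>F h in at 0. cmod (f (x0 + h) - f x0) \<le> (cmod D + 1) * \<bar>h\<bar>"
    using eventually_neq_at_within[of 0 0 UNIV]
  proof eventually_elim
    case (elim h)
    then have h: "\<bar>h\<bar> > 0" by auto
    have "cmod (f (x0 + h) - f x0 - h *\<^sub>R D) \<le> \<bar>h\<bar>"
      using elim h by (simp add: field_simps)
    then show ?case
      using norm_triangle_sub[of "f (x0 + h) - f x0" "h *\<^sub>R D"] by (simp add: algebra_simps)
  qed
  then show ?thesis
    by (subst at_to_0) (simp add: eventually_filtermap add.commute)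
qed

text \<open>A crude bound, summing over all entries, hence the factor
  \<open>(real n)\<^sup>2\<close>; for the derivative only the order in \<open>x - x0\<close>
  matters.\<close>

lemma norm_cscalar_le:
  fixes B :: "complex mat"
  assumes B: "B \<in> carrier_mat n n" and u: "u \<in> carrier_vec n" and y: "y \<in> carrier_vec n"
    and b: "\<And>i j. i < n \<Longrightarrow> j < n \<Longrightarrow> cmod (B $$ (i, j)) \<le> b" and b0: "b \<ge> 0"
  shows "cmod (u \<bullet>c (B *\<^sub>v y)) \<le> (real n)\<^sup>2 * b * (sqrt (norm2_vec u) * sqrt (norm2_vec y))"
proof -
  have comp: "cmod (v $ i) \<le> sqrt (norm2_vec v)" if "v \<in> carrier_vec n" "i < n" for v i
    using that by (intro real_le_rsqrt) (auto simp: norm2_vec_def intro!: member_le_sum)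
  have "u \<bullet>c (B *\<^sub>v y) = (\<Sum>i<n. \<Sum>j<n. u $ i * cnj (B $$ (i, j) * y $ j))"
    using B u y by (simp add: scalar_prod_def sum_distrib_left atLeast0LessThan)
  also have "cmod \<dots> \<le> (\<Sum>i<n. \<Sum>j<n. b * (sqrt (norm2_vec u) * sqrt (norm2_vec y)))"
  proof (intro order_trans[OF norm_sum] sum_mono)
    fix i j assume "i \<in> {..<n}" "j \<in> {..<n}"
    then have "cmod (u $ i) * (cmod (B $$ (i, j)) * cmod (y $ j)) \<le>
        sqrt (norm2_vec u) * (b * sqrt (norm2_vec y))"
      using u y by (intro mult_mono comp b) (auto intro!: mult_nonneg_nonneg b0)
    then show "cmod (u $ i * cnj (B $$ (i, j) * y $ j)) \<le> b * (sqrt (norm2_vec u) * sqrt (norm2_vec y))"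
      by (simp add: norm_mult mult_ac)
  qed
  finally show ?thesis by (simp add: power2_eq_square mult_ac)
qed

lemma cscalar_mult_mat_minus:
  fixes A B :: "complex mat"
  assumes "A \<in> carrier_mat n n" "B \<in> carrier_mat n n" "u \<in> carrier_vec n" "y \<in> carrier_vec n"
  shows "u \<bullet>c ((A - B) *\<^sub>v y) = u \<bullet>c (A *\<^sub>v y) - u \<bullet>c (B *\<^sub>v y)"
  using assms by (simp add: scalar_prod_def sum_subtractf left_diff_distrib right_diff_distrib)

text \<open>Here \<open>s\<close> is the largest eigenvalue, \<open>\<mu>\<close> bounds the others, \<open>p\<close> is the perturbed quadratic form
  at the unperturbed eigenvector, \<open>\<epsilon>\<close> the size of the perturbation and \<open>t\<close> the norm of the component
  orthogonal to the eigenvector; the bound follows by completing the square in \<open>t\<close>.\<close>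

lemma second_order_gap_bound:
  fixes p s t \<mu> \<epsilon> :: real
  assumes p: "p \<ge> s - \<epsilon>" and g: "g = s - \<mu>" "4 * \<epsilon> \<le> g" "g > 0" and t: "t \<ge> 0"
    and x: "x \<le> (1 - t\<^sup>2) * p + 2 * \<epsilon> * t + (\<mu> + \<epsilon>) * t\<^sup>2"
  shows "x \<le> p + 2 * \<epsilon>\<^sup>2 / g"
proof -
  \<comment> \<open>From \<open>p \<ge> s - \<epsilon>\<close> one gets
    \<open>p - \<mu> - \<epsilon> \<ge> g - 2 * \<epsilon>\<close>, and
    \<open>4 * \<epsilon> \<le> g\<close> turns this into at least half the gap.\<close>
  have "t\<^sup>2 * (p - \<mu> - \<epsilon>) \<ge> t\<^sup>2 * (g / 2)"
    by (rule mult_left_mono) (use p g in auto)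
  then have "x \<le> p + 2 * \<epsilon> * t - t\<^sup>2 * (g / 2)" using x by (simp add: algebra_simps)
  moreover have "0 \<le> (g * t - 2 * \<epsilon>)\<^sup>2 / (2 * g)" using g by simp
  moreover have "(g * t - 2 * \<epsilon>)\<^sup>2 / (2 * g) = t\<^sup>2 * (g / 2) - 2 * \<epsilon> * t + 2 * \<epsilon>\<^sup>2 / g"
    using g by (simp add: power2_diff field_simps power2_eq_square)
  ultimately show ?thesis by linarith
qed

lemma sigma_max_has_derivative:
  fixes A :: "real \<Rightarrow> complex mat"
  assumes A: "\<And>x. A x \<in> carrier_mat n n" and n: "n > 0"
    and A': "\<And>i j. i < n \<Longrightarrow> j < n \<Longrightarrow> ((\<lambda>x. A x $$ (i, j)) has_vector_derivative A' i j) (at x0)"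
    and simp: "sigma_max_simple (A x0)"
    and v: "v \<in> carrier_vec n" "norm2_vec v = 1"
    and ev: "(mat_adjoint (A x0) * A x0) *\<^sub>v v = of_real ((sigma_max (A x0))\<^sup>2) \<cdot>\<^sub>v v"
    and pos: "sigma_max (A x0) > 0"
    and p': "((\<lambda>x. norm2_vec (A x *\<^sub>v v)) has_real_derivative 2 * sigma_max (A x0) * D) (at x0)"
  shows "((\<lambda>x. sigma_max (A x)) has_real_derivative D) (at x0)"
proof -
  define s where "s = (\<lambda>x. (sigma_max (A x))\<^sup>2)"
  define p where "p = (\<lambda>x. norm2_vec (A x *\<^sub>v v))"
  define B where "B = (\<lambda>x. mat_adjoint (A x) * A x)"
  have B: "B x \<in> carrier_mat n n" for x
    unfolding B_def by (rule mult_carrier_mat[OF mat_adjoint_carrier[OF A] A])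
  have v0: "v \<noteq> 0\<^sub>v n" using v by (auto simp: norm2_vec_def)
  have quad: "of_real (norm2_vec (A x *\<^sub>v u)) = u \<bullet>c (B x *\<^sub>v u)" if "u \<in> carrier_vec n" for x u
    using norm2_vec_mult_mat[OF A that] by (simp add: B_def)
  obtain \<mu> where \<mu>: "\<mu> < s x0"
    and gap: "\<And>y. y \<in> carrier_vec n \<Longrightarrow> y \<bullet>c v = 0 \<Longrightarrow> norm2_vec (A x0 *\<^sub>v y) \<le> \<mu> * norm2_vec y"
    using sigma_max_gap[OF A n simp v(1) v0 ev] by (auto simp: s_def)
  define g where "g = s x0 - \<mu>"
  have g: "g > 0" using \<mu> by (simp add: g_def)
  have p0: "p x0 = s x0"
  proof -
    have "complex_of_real (p x0) = of_real (s x0)"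
      using v ev by (simp add: p_def s_def quad B_def norm2_vec_cscalar conjugate_smult_vec flip: of_real_power)
    then show ?thesis by (simp only: of_real_eq_iff)
  qed
  have "\<exists>L. \<forall>i<n. \<forall>j<n. \<forall>\<^sub>F x in at x0. cmod (B x $$ (i, j) - B x0 $$ (i, j)) \<le> L * \<bar>x - x0\<bar>"
  proof -
    \<comment> \<open>The Lipschitz constant of one entry of \<open>B\<close>: the modulus of its
      derivative plus 1. The sum over all entries then serves as a common constant.\<close>
    define L where "L = (\<lambda>i j. cmod (\<Sum>k<n. cnj (A x0 $$ (k, i)) * A' k j + cnj (A' k i) * A x0 $$ (k, j)) + 1)"
    have "\<forall>\<^sub>F x in at x0. cmod (B x $$ (i, j) - B x0 $$ (i, j)) \<le> (\<Sum>i<n. \<Sum>j<n. L i j) * \<bar>x - x0\<bar>"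
      if ij: "i < n" "j < n" for i j
    proof -
      have "B x $$ (i, j) = (\<Sum>k<n. cnj (A x $$ (k, i)) * A x $$ (k, j))" for x
        using A[of x] ij by (simp add: B_def scalar_prod_def atLeast0LessThan)
      moreover have "((\<lambda>x. \<Sum>k<n. cnj (A x $$ (k, i)) * A x $$ (k, j)) has_vector_derivative
          (\<Sum>k<n. cnj (A x0 $$ (k, i)) * A' k j + cnj (A' k i) * A x0 $$ (k, j))) (at x0)"
        using A' ij by (intro has_vector_derivative_sum has_vector_derivative_mult
            bounded_linear.has_vector_derivative[OF bounded_linear_cnj]) auto
      ultimately have "((\<lambda>x. B x $$ (i, j)) has_vector_derivative
          (\<Sum>k<n. cnj (A x0 $$ (k, i)) * A' k j + cnj (A' k i) * A x0 $$ (k, j))) (at x0)"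
        by simp
      from has_vector_derivative_imp_Lipschitz_at[OF this]
      show ?thesis
      proof eventually_elim
        case (elim x)
        have L0: "L i j \<ge> 0" for i j by (simp add: L_def)
        have "L i j \<le> (\<Sum>j<n. L i j)" using ij L0 by (intro member_le_sum) auto
        also have "\<dots> \<le> (\<Sum>i<n. \<Sum>j<n. L i j)"
          using ij L0 by (intro member_le_sum[of i]) (auto intro!: sum_nonneg)
        finally have "L i j * \<bar>x - x0\<bar> \<le> (\<Sum>i<n. \<Sum>j<n. L i j) * \<bar>x - x0\<bar>"
          by (rule mult_right_mono) simp
        then show ?case using elim by (simp only: L_def)
      qed
    qed
    then show ?thesis by blast
  qed
  then obtain L where L: "\<And>i j. i < n \<Longrightarrow> j < n \<Longrightarrow>
      \<forall>\<^sub>F x in at x0. cmod (B x $$ (i, j) - B x0 $$ (i, j)) \<le> L * \<bar>x - x0\<bar>" by blast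
  have "\<forall>\<^sub>F x in at x0. \<forall>i\<in>{..<n}. \<forall>j\<in>{..<n}. cmod (B x $$ (i, j) - B x0 $$ (i, j)) \<le> L * \<bar>x - x0\<bar>"
    using L by (intro eventually_ball_finite ballI) auto
  \<comment> \<open>The factor from \<open>norm_cscalar_le\<close> turns the entrywise bound
    \<open>L\<close> into a bound for the sesquilinear form.\<close>
  moreover define C where "C = (real n)\<^sup>2 * L"
  have "((\<lambda>x. 4 * (C * \<bar>x - x0\<bar>)) \<longlongrightarrow> 4 * (C * \<bar>x0 - x0\<bar>)) (at x0)" by (intro tendsto_intros)
  then have "\<forall>\<^sub>F x in at x0. 4 * (C * \<bar>x - x0\<bar>) < g"
    by (rule order_tendstoD) (use g in simp)
  ultimately have "\<forall>\<^sub>F x in at x0. p x \<le> s x \<and> s x \<le> p x + 2 * (C * \<bar>x - x0\<bar>)\<^sup>2 / g"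
  proof eventually_elim
    case (elim x)
    define \<epsilon> where "\<epsilon> = C * \<bar>x - x0\<bar>"
    have pert: "cmod (u \<bullet>c (B x *\<^sub>v y) - u \<bullet>c (B x0 *\<^sub>v y)) \<le> \<epsilon> * (sqrt (norm2_vec u) * sqrt (norm2_vec y))"
      if u: "u \<in> carrier_vec n" and y: "y \<in> carrier_vec n" for u y
    proof -
      \<comment> \<open>No sign of \<open>L\<close> is known; the entry (0, 0), present because
        \<open>n > 0\<close>, shows that the bound is nonnegative.\<close>
      have "cmod (B x $$ (0, 0) - B x0 $$ (0, 0)) \<le> L * \<bar>x - x0\<bar>" using elim n by auto
      then have "0 \<le> L * \<bar>x - x0\<bar>" using norm_ge_zero order_trans by blast
      then have "cmod (u \<bullet>c ((B x - B x0) *\<^sub>v y)) \<le> (real n)\<^sup>2 * (L * \<bar>x - x0\<bar>) * (sqrt (norm2_vec u) * sqrt (norm2_vec y))"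
        by (intro norm_cscalar_le[OF _ u y]) (use B[of x] B[of x0] elim in auto)
      then show ?thesis using cscalar_mult_mat_minus[OF B B u y] by (simp add: \<epsilon>_def C_def mult_ac)
    qed
    have pert_quad: "\<bar>norm2_vec (A x *\<^sub>v u) - norm2_vec (A x0 *\<^sub>v u)\<bar> \<le> \<epsilon> * norm2_vec u"
      if u: "u \<in> carrier_vec n" for u
      using pert[OF u u] by (simp add: quad[OF u, symmetric] flip: of_real_diff)
    have px: "p x \<ge> s x0 - \<epsilon>"
      using pert_quad[OF v(1)] v(2) p0 by (simp add: p_def)
    have lower: "p x \<le> s x"
      using norm2_mult_le_sigma_max[OF A n v(1), of x] v(2) by (simp add: p_def s_def)
    \<comment> \<open>A maximiser of the perturbed form, to be written as
      \<open>a \<cdot>\<^sub>v v + y\<close> with \<open>y\<close> orthogonal to \<open>v\<close>.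
      The gap controls the contribution of \<open>y\<close>, and \<open>p x\<close> that of
      \<open>v\<close>.\<close>
    obtain u where u: "u \<in> carrier_vec n" "norm2_vec u = 1" and us: "norm2_vec (A x *\<^sub>v u) = s x"
      using sigma_max_attained[OF A n, of x] by (auto simp: s_def)
    define a where "a = u \<bullet>c v"
    define y where "y = u + (- a) \<cdot>\<^sub>v v"
    have y: "y \<in> carrier_vec n" using u v by (simp add: y_def)
    have yv: "y \<bullet>c v = 0"
      using u v by (simp add: y_def a_def add_scalar_prod_distrib[of _ n] norm2_vec_cscalar)
    have vy: "v \<bullet>c y = 0"
      using yv conjugate_conjugate_sprod[OF y v(1)] y v(1)
      by (metis conjugate_zero_iff conjugate_vec_sprod_comm)
    have u_eq: "u = a \<cdot>\<^sub>v v + y"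
      using u v by (auto simp: y_def vec_eq_iff)
    define t where "t = sqrt (norm2_vec y)"
    have t: "t \<ge> 0" "norm2_vec y = t\<^sup>2" by (simp_all add: t_def)
    have av: "a \<cdot>\<^sub>v v \<in> carrier_vec n" using v by simp
    have a2: "(cmod a)\<^sup>2 = 1 - t\<^sup>2"
      using u(2) norm2_vec_add[OF av y] v vy y t(2) by (simp add: u_eq[symmetric] norm2_vec_smult)
    have a1: "cmod a \<le> 1" using a2 by (simp add: power2_le_imp_le[of _ 1])
    \<comment> \<open>\<open>B x0\<close> is self-adjoint with eigenvector \<open>v\<close>, so it
      does not mix \<open>v\<close> with its orthogonal complement. The mixed term at
      \<open>x\<close> is therefore pure perturbation.\<close>
    have B0vy: "v \<bullet>c (B x0 *\<^sub>v y) = 0"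
    proof -
      have "mat_adjoint (B x0) = B x0" 
        unfolding B_def using mat_adjoint_mult[OF mat_adjoint_carrier[OF A] A, of x0 x0] by simp
      then have "v \<bullet>c (B x0 *\<^sub>v y) = (B x0 *\<^sub>v v) \<bullet>c y"
        using mult_mat_vec_cscalar[OF B v(1) y, of x0] by simp
      then show ?thesis using ev vy v y by (simp add: B_def)
    qed
    have Av: "A x *\<^sub>v v \<in> carrier_vec n" and Ay: "A x *\<^sub>v y \<in> carrier_vec n"
      using A v y by (auto intro: mult_mat_vec_carrier)
    have "(A x *\<^sub>v v) \<bullet>c (A x *\<^sub>v y) = v \<bullet>c (B x *\<^sub>v y)"
      using mult_mat_vec_cscalar[OF A v(1) Ay] assoc_mult_mat_vec[OF mat_adjoint_carrier[OF A] A y]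
      by (simp add: B_def)
    then have cross: "cmod ((A x *\<^sub>v v) \<bullet>c (A x *\<^sub>v y)) \<le> \<epsilon> * t"
      using pert[OF v(1) y] B0vy v(2) by (simp add: t_def)
    have "A x *\<^sub>v u = a \<cdot>\<^sub>v (A x *\<^sub>v v) + A x *\<^sub>v y"
      using A v y av by (simp add: u_eq mult_add_distrib_mat_vec[of _ n n] mult_mat_vec[of _ n n])
    then have "s x = (cmod a)\<^sup>2 * p x + 2 * Re (a * ((A x *\<^sub>v v) \<bullet>c (A x *\<^sub>v y))) + norm2_vec (A x *\<^sub>v y)"
      using us norm2_vec_add[of "a \<cdot>\<^sub>v (A x *\<^sub>v v)" n "A x *\<^sub>v y"] Av Ay
      by (simp add: norm2_vec_smult p_def)
    moreover have "Re (a * ((A x *\<^sub>v v) \<bullet>c (A x *\<^sub>v y))) \<le> \<epsilon> * t"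
    proof -
      have "Re (a * ((A x *\<^sub>v v) \<bullet>c (A x *\<^sub>v y))) \<le> cmod a * cmod ((A x *\<^sub>v v) \<bullet>c (A x *\<^sub>v y))"
        by (metis complex_Re_le_cmod norm_mult)
      also have "\<dots> \<le> 1 * (\<epsilon> * t)" by (rule mult_mono) (use a1 cross in auto)
      finally show ?thesis by simp
    qed
    moreover have "norm2_vec (A x *\<^sub>v y) \<le> (\<mu> + \<epsilon>) * t\<^sup>2"
      using pert_quad[OF y] gap[OF y yv] t(2) by (simp add: algebra_simps)
    ultimately have "s x \<le> (1 - t\<^sup>2) * p x + 2 * \<epsilon> * t + (\<mu> + \<epsilon>) * t\<^sup>2"
      unfolding a2 by linarith
    from second_order_gap_bound[OF px g_def _ g t(1) this] elim lower show ?case by (simp add: \<epsilon>_def)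
  qed
  then have "\<forall>\<^sub>F x in at x0. \<bar>s x - p x\<bar> \<le> (2 * C\<^sup>2 / g) * (x - x0)\<^sup>2"
    by eventually_elim (simp add: power_mult_distrib)
  \<comment> \<open>The difference has derivative 0 at \<open>x0\<close>, so \<open>s\<close>
    inherits the derivative of \<open>p\<close>; the chain rule for \<open>sqrt\<close> then gives
    the maximal singular value itself.\<close>
  then have "((\<lambda>x. s x - p x) has_real_derivative 0) (at x0)"
    by (rule DERIV_zero_if_quadratic_bound) (simp add: p0)
  from DERIV_add[OF this p'[folded p_def]]
  have "(s has_real_derivative 2 * sigma_max (A x0) * D) (at x0)" by simp
  moreover have "s x0 > 0" using pos by (simp add: s_def)
  ultimately have "((\<lambda>x. sqrt (s x)) has_real_derivative
      inverse (sqrt (s x0)) / 2 * (2 * sigma_max (A x0) * D)) (at x0)"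
    by (intro DERIV_chain2[where f = sqrt and g = s] DERIV_real_sqrt)
  moreover have "sqrt (s x) = sigma_max (A x)" for x
    using sigma_max_nonneg[OF A n] by (simp add: s_def)
  ultimately show ?thesis using pos by (simp add: field_simps)
qed

section \<open>Sensitivity of the network gain\<close>

lemma node_vec_conv:
  assumes "finite N"
  shows "node_vec N E f = vec (card (ordering_nodes N E)) (\<lambda>a. f (sorted_list_of_set (ordering_nodes N E) ! a))"
  using assms by (auto simp: node_vec_def vec_of_list_index ordering_nodes_def)

lemma bij_betw_ordering_nodes:
  assumes "finite N"
  shows "bij_betw ((!) (sorted_list_of_set (ordering_nodes N E))) {..<card (ordering_nodes N E)} (ordering_nodes N E)"
  using assms by (intro bij_betw_nth) (auto simp: ordering_nodes_def)

lemma node_vec_carrier [simp]: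
  "finite N \<Longrightarrow> node_vec N E f \<in> carrier_vec (card (ordering_nodes N E))"
  by (simp add: node_vec_conv)

lemma node_vec_surj:
  assumes fin: "finite N" and v: "v \<in> carrier_vec (card (ordering_nodes N E))"
  obtains f where "node_vec N E f = v"
proof
  show "node_vec N E (\<lambda>i. v $ inv_into {..<card (ordering_nodes N E)}
      ((!) (sorted_list_of_set (ordering_nodes N E))) i) = v"
    using v bij_betw_ordering_nodes[OF fin, of E]
    by (auto simp: node_vec_conv[OF fin] bij_betw_def inv_into_f_f intro!: eq_vecI)
qed

lemma node_vec_eq_iff:
  assumes fin: "finite N"
  shows "node_vec N E f = node_vec N E g \<longleftrightarrow> (\<forall>j\<in>ordering_nodes N E. f j = g j)"
proof -
  let ?xs = "sorted_list_of_set (ordering_nodes N E)"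
  have "node_vec N E f = node_vec N E g \<longleftrightarrow> (\<forall>j\<in>(!) ?xs ` {..<card (ordering_nodes N E)}. f j = g j)"
    by (auto simp: node_vec_conv[OF fin] vec_eq_iff)
  then show ?thesis
    using bij_betw_imp_surj_on[OF bij_betw_ordering_nodes[OF fin, of E]] by simp
qed

lemma node_vec_smult: "finite N \<Longrightarrow> node_vec N E (\<lambda>i. c * f i) = c \<cdot>\<^sub>v node_vec N E f"
  by (auto simp: node_vec_conv)

lemma norm2_vec_node_vec:
  assumes fin: "finite N"
  shows "norm2_vec (node_vec N E f) = (\<Sum>j\<in>ordering_nodes N E. (cmod (f j))\<^sup>2)"
  using sum.reindex_bij_betw[OF bij_betw_ordering_nodes[OF fin, of E], of "\<lambda>j. (cmod (f j))\<^sup>2"]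
  by (simp add: norm2_vec_def node_vec_conv[OF fin])

lemma transfer_matrix_spec:
  fixes N :: "'a::linorder set"
  assumes fin: "finite N" and EN: "E \<subseteq> N \<times> N" and topo: "\<And>c j. (c, j) \<in> E \<Longrightarrow> c < j"
  shows transfer_matrix_carrier: "transfer_matrix N E \<beta> \<tau> w K s
      \<in> carrier_mat (card (ordering_nodes N E)) (card (ordering_nodes N E))"
    and order_equations_iff: "order_equations N E \<beta> \<tau> w K s v q \<longleftrightarrow>
      node_vec N E q = transfer_matrix N E \<beta> \<tau> w K s *\<^sub>v node_vec N E v"
  using theI'[OF transfer_matrix_ex1[OF assms, where \<beta> = \<beta> and \<tau> = \<tau> and w = w and K = K and s = s]]
  unfolding transfer_matrix_def by blast+

lemma customers_eq_ordering:
  assumes "E \<subseteq> N \<times> N"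
  shows "customers E j = {k \<in> ordering_nodes N E. (k, j) \<in> E}"
  using assms by (auto simp: customers_def ordering_nodes_def source_nodes_def suppliers_def)

text \<open>Induction along the topological order: the equation of node \<open>j\<close> involves
  only the orders of its customers, which precede \<open>j\<close>. The derivative of the solution
  thus exists without differentiating an inverse matrix; the equations determine its value
  later.\<close>

lemma orders_differentiable:
  fixes N :: "'a::linorder set" and w :: "real \<Rightarrow> 'a \<times> 'a \<Rightarrow> real" and q :: "real \<Rightarrow> 'a \<Rightarrow> complex"
  assumes fin: "finite N" and EN: "E \<subseteq> N \<times> N" and topo: "\<And>c j. (c, j) \<in> E \<Longrightarrow> c < j"
    and tr: "\<And>j. j \<in> ordering_nodes N E \<Longrightarrow>
        ((\<lambda>x. node_transfer E \<beta> (\<tau> x) (w x) (K x) j s) has_vector_derivative tr' j) (at x0)"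
    and w: "\<And>e. e \<in> E \<Longrightarrow> ((\<lambda>x. w x e) has_real_derivative w' e) (at x0)"
    and q: "\<And>x. order_equations N E \<beta> (\<tau> x) (w x) (K x) s v (q x)"
    and j: "j \<in> ordering_nodes N E"
  shows "\<exists>d. ((\<lambda>x. q x j) has_vector_derivative d) (at x0)"
  using j
proof (induction "card {k \<in> ordering_nodes N E. k < j}" arbitrary: j rule: less_induct)
  case less
  let ?R = "ordering_nodes N E"
  have finR: "finite ?R" using fin by (simp add: ordering_nodes_def)
  have "\<exists>d. ((\<lambda>x. q x k) has_vector_derivative d) (at x0)" if "k \<in> customers E j" for k
  proof (rule less(1))
    show k: "k \<in> ?R" using that by (simp add: customers_eq_ordering[OF EN])
    have "k < j" using that topo by (simp add: customers_def)
    then show "card {l \<in> ?R. l < k} < card {l \<in> ?R. l < j}"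
      using finR k by (intro psubset_card_mono) auto
  qed
  then obtain d where d: "\<And>k. k \<in> customers E j \<Longrightarrow> ((\<lambda>x. q x k) has_vector_derivative d k) (at x0)"
    by metis
  have qj: "q x j = node_transfer E \<beta> (\<tau> x) (w x) (K x) j s *
      ((\<Sum>k\<in>customers E j. of_real (w x (k, j)) * q x k) + v j)" for x
    using q[of x] less(2) by (simp add: order_equations_def)
  \<comment> \<open>The summand 0 is the derivative of the fixed exogenous demand
    \<open>v j\<close>.\<close>
  have "((\<lambda>x. q x j) has_vector_derivative
      node_transfer E \<beta> (\<tau> x0) (w x0) (K x0) j s *
        ((\<Sum>k\<in>customers E j. of_real (w x0 (k, j)) * d k + of_real (w' (k, j)) * q x0 k) + 0) +
      tr' j * ((\<Sum>k\<in>customers E j. of_real (w x0 (k, j)) * q x0 k) + v j)) (at x0)"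
    unfolding qj
    by (intro has_vector_derivative_mult has_vector_derivative_add has_vector_derivative_sum
        has_vector_derivative_const has_vector_derivative_of_real tr[OF less(2)] d w)
      (auto simp: customers_def)
  then show ?case by blast
qed

text \<open>In \<open>tr' j / T j * q j\<close> the quotient \<open>q j / T j\<close> is the total
  demand arriving at \<open>j\<close>, so the term is the direct effect of a changing
  \<open>T j\<close>; the sum with \<open>w'\<close> is the direct effect of changing weights. The
  adjoint variable \<psi> carries these effects to the gain. It contains the factor
  \<open>c\<close>, which the final division removes.\<close>

lemma network_gain_has_derivative:
  fixes N :: "'a::linorder set" and w :: "real \<Rightarrow> 'a \<times> 'a \<Rightarrow> real" and c :: real
    and \<psi> \<eta> q :: "'a \<Rightarrow> complex"
  assumes fin: "finite N" and EN: "E \<subseteq> N \<times> N" and topo: "\<And>c j. (c, j) \<in> E \<Longrightarrow> c < j"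
    and R: "ordering_nodes N E \<noteq> {}"
    and tr: "\<And>j. j \<in> ordering_nodes N E \<Longrightarrow>
        ((\<lambda>x. node_transfer E \<beta> (\<tau> x) (w x) (K x) j s) has_vector_derivative tr' j) (at x0)"
    and w: "\<And>e. e \<in> E \<Longrightarrow> ((\<lambda>x. w x e) has_real_derivative w' e) (at x0)"
    and T: "\<And>j. T j = node_transfer E \<beta> (\<tau> x0) (w x0) (K x0) j s"
    and T0: "\<And>j. j \<in> ordering_nodes N E \<Longrightarrow> T j \<noteq> 0"
    and M: "\<And>x. M x = transfer_matrix N E \<beta> (\<tau> x) (w x) (K x) s"
    and simple: "sigma_max_simple (M x0)"
    and eta: "unit_left_singular_vector (M x0) (sigma_max (M x0)) (node_vec N E \<eta>)"
    and q: "\<And>i. q i = of_real (sigma_max (M x0)) * \<eta> i"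
    and c: "c \<noteq> 0"
    and psi: "\<And>i. i \<in> ordering_nodes N E \<Longrightarrow> \<psi> i = of_real c * cnj (\<eta> i) +
        (\<Sum>j\<in>suppliers E i. of_real (w x0 (i, j)) * (if j \<in> source_nodes N E then 0 else T j * \<psi> j))"
  shows "((\<lambda>x. sigma_max (M x)) has_real_derivative
      Re (\<Sum>j\<in>ordering_nodes N E. \<psi> j * (tr' j / T j * q j +
        T j * (\<Sum>k\<in>customers E j. of_real (w' (k, j)) * q k))) / c) (at x0)"
proof -
  let ?R = "ordering_nodes N E"
  define n where "n = card ?R"
  define \<sigma> where "\<sigma> = sigma_max (M x0)"
  have finR: "finite ?R" using fin by (simp add: ordering_nodes_def)
  then have n: "n > 0" using R by (simp add: n_def card_gt_0_iff)
  note spec = transfer_matrix_spec[OF fin EN topo]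
  have Mc: "M x \<in> carrier_mat n n" for x using spec(1) by (simp add: M n_def)
  have nvc: "node_vec N E f \<in> carrier_vec n" for f using fin by (simp add: n_def)
  have iff: "order_equations N E \<beta> (\<tau> x) (w x) (K x) s u r \<longleftrightarrow> node_vec N E r = M x *\<^sub>v node_vec N E u"
    for x u r unfolding M by (rule spec(2))
  have sol: "\<exists>r. \<forall>x. node_vec N E (r x) = M x *\<^sub>v node_vec N E u" for u
  proof -
    have "\<exists>r. node_vec N E r = M x *\<^sub>v node_vec N E u" for x
      using node_vec_surj[OF fin, of "M x *\<^sub>v node_vec N E u" E] mult_mat_vec_carrier[OF Mc nvc]
      by (metis n_def)
    then show ?thesis by metis
  qed
  have diff: "\<exists>r'. \<forall>j\<in>?R. ((\<lambda>x. r x j) has_vector_derivative r' j) (at x0)"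
    if r: "\<And>x. node_vec N E (r x) = M x *\<^sub>v node_vec N E u" for r u
  proof -
    have "\<exists>d. ((\<lambda>x. r x j) has_vector_derivative d) (at x0)" if "j \<in> ?R" for j
      by (rule orders_differentiable[OF fin EN topo tr w _ that]) (use r iff in auto)
    then show ?thesis by metis
  qed

  \<comment> \<open>Column \<open>j\<close> of the transfer matrix is the response to a unit demand
    at position \<open>j\<close>, so each entry is an order and \<open>orders_differentiable\<close>
    applies.\<close>
  have entries: "\<exists>d. ((\<lambda>x. M x $$ (i, j)) has_vector_derivative d) (at x0)" if ij: "i < n" "j < n" for i j
  proof -
    obtain u where u: "node_vec N E u = unit_vec n j"
      using node_vec_surj[OF fin, of "unit_vec n j" E] by (metis n_def unit_vec_carrier)
    obtain r where r: "\<And>x. node_vec N E (r x) = M x *\<^sub>v node_vec N E u" using sol by blast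
    obtain r' where r': "\<And>j. j \<in> ?R \<Longrightarrow> ((\<lambda>x. r x j) has_vector_derivative r' j) (at x0)"
      using diff[OF r] by blast
    let ?k = "sorted_list_of_set ?R ! i"
    have "M x $$ (i, j) = r x ?k" for x
    proof -
      have "r x ?k = node_vec N E (r x) $ i" using ij by (simp add: node_vec_conv[OF fin] n_def)
      then show ?thesis using Mc[of x] ij by (simp only: r u) simp
    qed
    moreover have "?k \<in> ?R"
      using bij_betwE[OF bij_betw_ordering_nodes[OF fin, of E]] ij by (auto simp: n_def)
    ultimately show ?thesis using r' by auto
  qed
  obtain M' where M': "\<And>i j. i < n \<Longrightarrow> j < n \<Longrightarrow> ((\<lambda>x. M x $$ (i, j)) has_vector_derivative M' i j) (at x0)"
    using entries by metis

  obtain v where v: "v \<in> carrier_vec n" "v \<bullet>c v = 1"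
    and Mv: "M x0 *\<^sub>v v = of_real \<sigma> \<cdot>\<^sub>v node_vec N E \<eta>"
    and Mu: "mat_adjoint (M x0) *\<^sub>v node_vec N E \<eta> = of_real \<sigma> \<cdot>\<^sub>v v"
    using eta Mc[of x0] by (auto simp: unit_left_singular_vector_def \<sigma>_def)
  have v1: "norm2_vec v = 1" using v(2) by (simp add: norm2_vec_cscalar)
  have "(mat_adjoint (M x0) * M x0) *\<^sub>v v = mat_adjoint (M x0) *\<^sub>v (M x0 *\<^sub>v v)"
    by (rule assoc_mult_mat_vec[OF mat_adjoint_carrier[OF Mc] Mc v(1)])
  also have "\<dots> = of_real \<sigma> \<cdot>\<^sub>v (mat_adjoint (M x0) *\<^sub>v node_vec N E \<eta>)"
    unfolding Mv by (rule mult_mat_vec[OF mat_adjoint_carrier[OF Mc] nvc])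
  also have "\<dots> = of_real (\<sigma>\<^sup>2) \<cdot>\<^sub>v v" unfolding Mu by (simp add: smult_smult_assoc power2_eq_square)
  finally have ev: "(mat_adjoint (M x0) * M x0) *\<^sub>v v = of_real ((sigma_max (M x0))\<^sup>2) \<cdot>\<^sub>v v"
    by (simp add: \<sigma>_def)

  obtain d where d: "node_vec N E d = v"
    using node_vec_surj[OF fin, of v E] v(1) by (metis n_def)
  obtain r where r: "\<And>x. node_vec N E (r x) = M x *\<^sub>v node_vec N E d" using sol by blast
  obtain r' where r': "\<And>j. j \<in> ?R \<Longrightarrow> ((\<lambda>x. r x j) has_vector_derivative r' j) (at x0)"
    using diff[OF r] by blast
  have rq: "r x0 j = q j" if "j \<in> ?R" for j
  proof -
    have "q = (\<lambda>i. of_real \<sigma> * \<eta> i)" by (rule ext) (simp add: q \<sigma>_def)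
    then have "node_vec N E (r x0) = node_vec N E q"
      using r[of x0] Mv by (simp add: d node_vec_smult[OF fin])
    then show ?thesis using that node_vec_eq_iff[OF fin] by blast
  qed
  have req: "r x j = node_transfer E \<beta> (\<tau> x) (w x) (K x) j s *
      ((\<Sum>k\<in>customers E j. of_real (w x (k, j)) * r x k) + d j)" if "j \<in> ?R" for x j
    using r[of x] that unfolding iff[symmetric] order_equations_def by blast
  have cust: "k \<in> ?R" "(k, j) \<in> E" if "k \<in> customers E j" for k j
    using that by (auto simp: customers_eq_ordering[OF EN])

  \<comment> \<open>If the maximal singular value were 0, the demand \<open>v\<close> would cause no
    orders. As no \<open>T j\<close> vanishes, the order equations would then force \<open>v\<close>
    to be 0, although it is a unit vector.\<close>
  have pos: "\<sigma> > 0"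
  proof (rule ccontr)
    assume "\<not> \<sigma> > 0"
    then have "\<sigma> = 0" using sigma_max_nonneg[OF Mc n, of x0] by (simp add: \<sigma>_def)
    then have q0: "r x0 j = 0" if "j \<in> ?R" for j using that by (simp add: rq q \<sigma>_def)
    have "d j = 0" if j: "j \<in> ?R" for j
    proof -
      have "(\<Sum>k\<in>customers E j. of_real (w x0 (k, j)) * r x0 k) = 0"
        by (rule sum.neutral) (use q0 cust in auto)
      then show ?thesis using req[OF j, of x0] q0[OF j] T0[OF j] by (simp add: T)
    qed
    then have "norm2_vec v = 0" by (simp add: d[symmetric] norm2_vec_node_vec[OF fin])
    then show False using v1 by simp
  qed

  have r'_eq: "r' j = tr' j / T j * q j + T j * (\<Sum>k\<in>customers E j. of_real (w' (k, j)) * q k)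
      + T j * (\<Sum>k\<in>customers E j. of_real (w x0 (k, j)) * r' k)" if j: "j \<in> ?R" for j
  proof -
    let ?D = "(\<Sum>k\<in>customers E j. of_real (w x0 (k, j)) * r x0 k) + d j"
    have "((\<lambda>x. r x j) has_vector_derivative
        T j * ((\<Sum>k\<in>customers E j. of_real (w x0 (k, j)) * r' k + of_real (w' (k, j)) * r x0 k) + 0) +
        tr' j * ?D) (at x0)"
      unfolding req[OF j] T
      by (intro has_vector_derivative_mult has_vector_derivative_add has_vector_derivative_sum
        has_vector_derivative_const has_vector_derivative_of_real tr[OF j] r' w cust)
    then have "r' j = T j * ((\<Sum>k\<in>customers E j. of_real (w x0 (k, j)) * r' k + of_real (w' (k, j)) * r x0 k) + 0) +
        tr' j * ?D"
      by (rule has_vector_derivative_unique[OF r'[OF j]])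
    \<comment> \<open>The order equation at \<open>x0\<close>, solved for the total demand.\<close>
    moreover have "?D = q j / T j" using req[OF j, of x0] rq[OF j] T0[OF j] by (simp add: T)
    moreover have "(\<Sum>k\<in>customers E j. of_real (w' (k, j)) * r x0 k) = (\<Sum>k\<in>customers E j. of_real (w' (k, j)) * q k)"
      by (rule sum.cong) (use rq cust in auto)
    ultimately show ?thesis by (simp add: sum.distrib distrib_left)
  qed

  \<comment> \<open>Summation by parts over the edges: the recursion for \<psi> sums over suppliers,
    the linearised order equations over customers, and exchanging the two sums cancels every
    occurrence of \<open>r'\<close> but the one paired with \<eta>.\<close>
  have adjoint: "of_real c * (\<Sum>j\<in>?R. cnj (\<eta> j) * r' j) =
      (\<Sum>j\<in>?R. \<psi> j * (tr' j / T j * q j + T j * (\<Sum>k\<in>customers E j. of_real (w' (k, j)) * q k)))"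
  proof -
    \<comment> \<open>Suppliers that are sources contribute 0, so the recursion lives on ordering
      nodes, as the exchange of sums requires.\<close>
    have supp: "(\<Sum>j\<in>suppliers E i. of_real (w x0 (i, j)) * (if j \<in> source_nodes N E then 0 else T j * \<psi> j)) =
        (\<Sum>j\<in>{j \<in> ?R. (i, j) \<in> E}. of_real (w x0 (i, j)) * (T j * \<psi> j))" for i
    proof (rule sum.mono_neutral_cong_right)
      show "finite (suppliers E i)"
        by (rule finite_subset[OF _ fin]) (use EN in \<open>auto simp: suppliers_def\<close>)
    qed (use EN in \<open>auto simp: suppliers_def ordering_nodes_def\<close>)
    have "(\<Sum>i\<in>?R. (\<Sum>j\<in>{j \<in> ?R. (i, j) \<in> E}. of_real (w x0 (i, j)) * (T j * \<psi> j)) * r' i) =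
        (\<Sum>i\<in>?R. \<Sum>j\<in>{j \<in> ?R. (i, j) \<in> E}. \<psi> j * (T j * (of_real (w x0 (i, j)) * r' i)))"
      unfolding sum_distrib_right by (simp add: mult_ac)
    also have "\<dots> = (\<Sum>j\<in>?R. \<Sum>i\<in>{i \<in> ?R. (i, j) \<in> E}. \<psi> j * (T j * (of_real (w x0 (i, j)) * r' i)))"
      by (rule sum.swap_restrict[OF finR finR])
    also have "\<dots> = (\<Sum>j\<in>?R. \<psi> j * (T j * (\<Sum>k\<in>customers E j. of_real (w x0 (k, j)) * r' k)))"
      by (simp add: customers_eq_ordering[OF EN] sum_distrib_left)
    finally have swap: "(\<Sum>i\<in>?R. (\<Sum>j\<in>{j \<in> ?R. (i, j) \<in> E}. of_real (w x0 (i, j)) * (T j * \<psi> j)) * r' i) =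
      (\<Sum>j\<in>?R. \<psi> j * (T j * (\<Sum>k\<in>customers E j. of_real (w x0 (k, j)) * r' k)))" .
    have "of_real c * (\<Sum>j\<in>?R. cnj (\<eta> j) * r' j) = (\<Sum>j\<in>?R. (of_real c * cnj (\<eta> j)) * r' j)"
      by (simp add: sum_distrib_left mult.assoc)
    also have "\<dots> = (\<Sum>j\<in>?R. \<psi> j * r' j) -
        (\<Sum>i\<in>?R. (\<Sum>j\<in>{j \<in> ?R. (i, j) \<in> E}. of_real (w x0 (i, j)) * (T j * \<psi> j)) * r' i)"
      unfolding sum_subtractf[symmetric]
    proof (rule sum.cong[OF refl])
      fix j assume "j \<in> ?R"
      then have "of_real c * cnj (\<eta> j) = \<psi> j -
          (\<Sum>k\<in>{k \<in> ?R. (j, k) \<in> E}. of_real (w x0 (j, k)) * (T k * \<psi> k))"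
        using psi[of j] unfolding supp by (simp only: add_diff_cancel_right')
      then show "of_real c * cnj (\<eta> j) * r' j = \<psi> j * r' j -
          (\<Sum>k\<in>{k \<in> ?R. (j, k) \<in> E}. of_real (w x0 (j, k)) * (T k * \<psi> k)) * r' j"
        by (simp only: left_diff_distrib)
    qed
    also have "\<dots> = (\<Sum>j\<in>?R. \<psi> j * (r' j - T j * (\<Sum>k\<in>customers E j. of_real (w x0 (k, j)) * r' k)))"
      unfolding swap sum_subtractf[symmetric] by (simp add: right_diff_distrib)
    also have "\<dots> = (\<Sum>j\<in>?R. \<psi> j * (tr' j / T j * q j + T j * (\<Sum>k\<in>customers E j. of_real (w' (k, j)) * q k)))"
      by (rule sum.cong) (simp_all add: r'_eq)
    finally show ?thesis .
  qed

  \<comment> \<open>The factor \<sigma> appears because at \<open>x0\<close> the order is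
    \<open>q j\<close>, that is, \<sigma> times \<open>\<eta> j\<close>.\<close>
  have "((\<lambda>x. (cmod (r x j))\<^sup>2) has_real_derivative 2 * \<sigma> * Re (cnj (\<eta> j) * r' j)) (at x0)"
    if j: "j \<in> ?R" for j
  proof -
    have "((\<lambda>x. Re (r x j * cnj (r x j))) has_vector_derivative
        Re (r x0 j * cnj (r' j) + r' j * cnj (r x0 j))) (at x0)"
      by (intro bounded_linear.has_vector_derivative[OF bounded_linear_Re] has_vector_derivative_mult
        bounded_linear.has_vector_derivative[OF bounded_linear_cnj] r' j)
    moreover have "Re (r x j * cnj (r x j)) = (cmod (r x j))\<^sup>2" for x
      by (simp add: complex_mult_cnj cmod_power2)
    moreover have "Re (r x0 j * cnj (r' j) + r' j * cnj (r x0 j)) = 2 * \<sigma> * Re (cnj (\<eta> j) * r' j)"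
      by (simp add: rq[OF j] q \<sigma>_def algebra_simps)
    ultimately show ?thesis by (simp add: has_real_derivative_iff_has_vector_derivative)
  qed
  then have "((\<lambda>x. \<Sum>j\<in>?R. (cmod (r x j))\<^sup>2) has_real_derivative
      (\<Sum>j\<in>?R. 2 * \<sigma> * Re (cnj (\<eta> j) * r' j))) (at x0)"
    by (rule DERIV_sum)
  moreover have "norm2_vec (M x *\<^sub>v v) = (\<Sum>j\<in>?R. (cmod (r x j))\<^sup>2)" for x
    using norm2_vec_node_vec[OF fin, of E "r x"] by (simp add: r d)
  ultimately have "((\<lambda>x. norm2_vec (M x *\<^sub>v v)) has_real_derivative
      2 * sigma_max (M x0) * Re (\<Sum>j\<in>?R. cnj (\<eta> j) * r' j)) (at x0)"
    by (simp only: Re_sum sum_distrib_left \<sigma>_def)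
  from sigma_max_has_derivative[OF Mc n M' simple v(1) v1 ev pos[unfolded \<sigma>_def] this]
  have "((\<lambda>x. sigma_max (M x)) has_real_derivative Re (\<Sum>j\<in>?R. cnj (\<eta> j) * r' j)) (at x0)" .
  \<comment> \<open>Multiplying and dividing by the real number \<open>c\<close> produces the
    left-hand side of \<open>adjoint\<close>.\<close>
  moreover have "Re (\<Sum>j\<in>?R. cnj (\<eta> j) * r' j) =
      Re (of_real c * (\<Sum>j\<in>?R. cnj (\<eta> j) * r' j)) / c"
    using c by simp
  ultimately show ?thesis unfolding adjoint by simp
qed

section \<open>Sensitivity of the smoothed peak gain\<close>

text \<open>Pulling \<open>exp (- (\<rho> * m))\<close> out of the sum cancels the shift
  \<open>m\<close>. This removes \<open>Max\<close>, which need not be differentiable where two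
  gains coincide.\<close>

lemma smooth_peak_gain_eq:
  assumes \<Omega>: "finite \<Omega>" "\<Omega> \<noteq> {}" and \<rho>: "\<rho> > 0"
  shows "smooth_peak_gain N E \<beta> \<tau>0 \<Omega> \<rho> w \<delta> K =
    ln (\<Sum>\<omega>\<in>\<Omega>. exp (\<rho> * network_gain N E \<beta> \<tau>0 w \<delta> K \<omega>)) / \<rho>"
proof -
  define \<sigma> where "\<sigma> = network_gain N E \<beta> \<tau>0 w \<delta> K"
  define m where "m = Max (\<sigma> ` \<Omega>)"
  have "(\<Sum>\<omega>\<in>\<Omega>. exp (\<rho> * (\<sigma> \<omega> - m))) = exp (- (\<rho> * m)) * (\<Sum>\<omega>\<in>\<Omega>. exp (\<rho> * \<sigma> \<omega>))"
    by (simp add: sum_distrib_left right_diff_distrib flip: exp_add)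
  moreover have "(\<Sum>\<omega>\<in>\<Omega>. exp (\<rho> * \<sigma> \<omega>)) > 0" using \<Omega> by (intro sum_pos) auto
  ultimately have "ln (\<Sum>\<omega>\<in>\<Omega>. exp (\<rho> * (\<sigma> \<omega> - m))) = - (\<rho> * m) + ln (\<Sum>\<omega>\<in>\<Omega>. exp (\<rho> * \<sigma> \<omega>))"
    by (simp add: ln_mult)
  then show ?thesis
    unfolding smooth_peak_gain_def Let_def \<sigma>_def[symmetric] m_def[symmetric]
    using \<rho> by (simp add: field_simps)
qed

text \<open>The gradient of log-sum-exp consists of the softmax weights. Each
  \<open>D \<omega>\<close> is meant to contain its weight already, through \<psi>; hence the
  division in the hypothesis and the unweighted sum in the conclusion.\<close>

lemma smooth_peak_gain_has_derivative:
  assumes \<Omega>: "finite \<Omega>" "\<Omega> \<noteq> {}" and \<rho>: "\<rho> > 0"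
    and \<sigma>: "\<sigma> = network_gain N E \<beta> \<tau>0 (w x0) (\<delta> x0) (K x0)"
    and D: "\<And>\<omega>. \<omega> \<in> \<Omega> \<Longrightarrow>
      ((\<lambda>x. network_gain N E \<beta> \<tau>0 (w x) (\<delta> x) (K x) \<omega>) has_real_derivative
        D \<omega> / (exp (\<rho> * \<sigma> \<omega>) / (\<Sum>\<omega>'\<in>\<Omega>. exp (\<rho> * \<sigma> \<omega>')))) (at x0)"
  shows "((\<lambda>x. smooth_peak_gain N E \<beta> \<tau>0 \<Omega> \<rho> (w x) (\<delta> x) (K x)) has_real_derivative
    (\<Sum>\<omega>\<in>\<Omega>. D \<omega>)) (at x0)"
proof -
  define S where "S = (\<Sum>\<omega>'\<in>\<Omega>. exp (\<rho> * \<sigma> \<omega>'))"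
  have S: "S > 0" unfolding S_def using \<Omega> by (intro sum_pos) auto
  have "((\<lambda>x. \<Sum>\<omega>\<in>\<Omega>. exp (\<rho> * network_gain N E \<beta> \<tau>0 (w x) (\<delta> x) (K x) \<omega>)) has_real_derivative
      (\<Sum>\<omega>\<in>\<Omega>. exp (\<rho> * \<sigma> \<omega>) * (\<rho> * (D \<omega> / (exp (\<rho> * \<sigma> \<omega>) / S))))) (at x0)"
  proof (rule DERIV_sum)
    fix \<omega> assume "\<omega> \<in> \<Omega>"
    from DERIV_fun_exp[OF DERIV_cmult[OF D[OF this], of \<rho>]]
    show "((\<lambda>x. exp (\<rho> * network_gain N E \<beta> \<tau>0 (w x) (\<delta> x) (K x) \<omega>)) has_real_derivative
        exp (\<rho> * \<sigma> \<omega>) * (\<rho> * (D \<omega> / (exp (\<rho> * \<sigma> \<omega>) / S)))) (at x0)"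
      by (simp only: \<sigma> S_def)
  qed
  also have "(\<Sum>\<omega>\<in>\<Omega>. exp (\<rho> * \<sigma> \<omega>) * (\<rho> * (D \<omega> / (exp (\<rho> * \<sigma> \<omega>) / S)))) = \<rho> * S * (\<Sum>\<omega>\<in>\<Omega>. D \<omega>)"
    unfolding sum_distrib_left by (rule sum.cong) (auto simp: field_simps)
  finally have 1: "((\<lambda>x. \<Sum>\<omega>\<in>\<Omega>. exp (\<rho> * network_gain N E \<beta> \<tau>0 (w x) (\<delta> x) (K x) \<omega>)) has_real_derivative
      \<rho> * S * (\<Sum>\<omega>\<in>\<Omega>. D \<omega>)) (at x0)" .
  have "((\<lambda>x. ln (\<Sum>\<omega>\<in>\<Omega>. exp (\<rho> * network_gain N E \<beta> \<tau>0 (w x) (\<delta> x) (K x) \<omega>)) / \<rho>) has_real_derivative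
      1 / S * (\<rho> * S * (\<Sum>\<omega>\<in>\<Omega>. D \<omega>)) / \<rho>) (at x0)"
  proof (intro DERIV_cdivide DERIV_chain2[OF _ 1])
    show "(ln has_real_derivative 1 / S)
        (at (\<Sum>\<omega>\<in>\<Omega>. exp (\<rho> * network_gain N E \<beta> \<tau>0 (w x0) (\<delta> x0) (K x0) \<omega>)))"
      using DERIV_ln_divide[OF S] by (simp only: S_def \<sigma>)
  qed
  then show ?thesis using S \<rho> by (simp add: smooth_peak_gain_eq[OF \<Omega> \<rho>])
qed

section \<open>First-order change of one node's transfer function\<close>

lemma supply_weight_upd_weight:
  assumes "finite (suppliers E i)" "(i, j) \<in> E"
  shows "supply_weight E \<beta> \<tau> (w((i, j) := x)) i s = supply_weight E \<beta> \<tau> w i s +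
    of_real (1 - \<beta> i) * (of_real x - of_real (w (i, j))) * exp (- (s * of_real (\<tau> (i, j))))"
proof -
  have j: "j \<in> suppliers E i" using assms by (simp add: suppliers_def)
  show ?thesis
    using assms(1) by (simp add: supply_weight_def sum.remove[OF _ j] algebra_simps)
qed

text \<open>As in the update of a weight, the parameter is isolated in one increment. Replacing
  \<open>of_real x\<close> by a complex variable gives a holomorphic function, whose complex
  derivative is afterwards restricted to the real line.\<close>

lemma supply_weight_upd_lead_time:
  assumes "finite (suppliers E i)" "(i, j) \<in> E"
  shows "supply_weight E \<beta> (lead_time \<tau>0 (\<delta>((i, j) := x))) w i s = supply_weight E \<beta> (lead_time \<tau>0 \<delta>) w i s +
    of_real (1 - \<beta> i) * of_real (w (i, j)) * (exp (- (s * (of_real (\<tau>0 (i, j)) - of_real x))) -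
      exp (- (s * of_real (lead_time \<tau>0 \<delta> (i, j)))))"
proof -
  have j: "j \<in> suppliers E i" using assms by (simp add: suppliers_def)
  show ?thesis
    using assms(1) by (simp add: supply_weight_def lead_time_def sum.remove[OF _ j] algebra_simps)
qed

text \<open>The factor \<open>T\<close> is split off at the end because the sensitivity formula
  divides by it: what remains, multiplied by the order and by \<psi>, is \<open>W'\<close> times
  \<Lambda>.\<close>

lemma node_transfer_has_derivative:
  fixes W :: "complex \<Rightarrow> complex"
  assumes W: "(W has_field_derivative W') (at x0)" and den: "s + k * W x0 \<noteq> 0"
    and num: "s + k \<noteq> 0"
    and T: "T = (s + k) / (s + k * W x0)"
  shows "((\<lambda>x. (s + k) / (s + k * W x)) has_field_derivative - (k * W' * T / (s + k)) * T) (at x0)"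
proof -
  have "((\<lambda>x. (s + k) / (s + k * W x)) has_field_derivative
      (0 * (s + k * W x0) - (s + k) * (0 + k * W')) / ((s + k * W x0) * (s + k * W x0))) (at x0)"
    by (intro DERIV_divide DERIV_const DERIV_add DERIV_cmult W den)
  moreover have "(0 * d - n * (0 + k * W')) / (d * d) = - (k * W' * (n / d) / n) * (n / d)"
    if "d \<noteq> 0" "n \<noteq> 0" for d n using that by (simp add: field_simps)
  ultimately show ?thesis unfolding T using den num by metis
qed

text \<open>The quotient rule gives \<open>s * (1 - W) / (s + k * W)\<^sup>2\<close>; expressing the
  denominator through \<open>T\<close> and \<open>s + k\<close> again leaves a factor
  \<open>T\<close> to be divided out.\<close>

lemma node_transfer_has_derivative_gain:
  fixes W s :: complex
  assumes den: "s + k * W \<noteq> 0" and num: "s + k \<noteq> 0"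
    and T: "T = (s + k) / (s + k * W)"
  shows "((\<lambda>k. (s + k) / (s + k * W)) has_field_derivative s * (1 - W) * T / (s + k)\<^sup>2 * T) (at k)"
  by (rule derivative_eq_intros den refl | simp)+
    (use den num in \<open>simp add: T divide_simps power2_eq_square; simp add: algebra_simps\<close>)

theorem theorem12:
  fixes N :: "'a::linorder set"
    and E :: "('a \<times> 'a) set"
    and \<beta> K :: "'a \<Rightarrow> real"
    and \<tau>0 \<tau> w \<delta> :: "'a \<times> 'a \<Rightarrow> real"
    and \<Omega> :: "real set"
    and \<rho> :: real
    and \<sigma> c :: "real \<Rightarrow> real"
    and \<eta> \<psi> q W T T\<psi> \<Lambda> :: "real \<Rightarrow> 'a \<Rightarrow> complex"
  assumes finite_nodes: "finite N"
    and edges: "E \<subseteq> {(u, v). u \<in> N \<and> v \<in> N \<and> u \<noteq> v}"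
    and topological: "\<And>u v. (u, v) \<in> E \<Longrightarrow> u < v"
    and tau: "\<tau> = lead_time \<tau>0 \<delta>"
    and tau_pos: "\<And>e. e \<in> E \<Longrightarrow> \<tau> e > 0"
    and K_pos: "\<And>i. i \<in> ordering_nodes N E \<Longrightarrow> K i > 0"
    and beta: "\<And>i. i \<in> ordering_nodes N E \<Longrightarrow> 0 \<le> \<beta> i \<and> \<beta> i < 1"
    and w_nonneg: "\<And>e. e \<in> E \<Longrightarrow> w e \<ge> 0"
    and w_sum: "\<And>i. i \<in> ordering_nodes N E \<Longrightarrow> (\<Sum>j\<in>suppliers E i. w (i, j)) = 1"
    and grid: "finite \<Omega>" "\<Omega> \<noteq> {}"
    and rho: "\<rho> > 0"
    and W: "\<And>\<omega> i. W \<omega> i = supply_weight E \<beta> \<tau> w i (\<i> * of_real \<omega>)"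
    and T: "\<And>\<omega> i. T \<omega> i = node_transfer E \<beta> \<tau> w K i (\<i> * of_real \<omega>)"
    and T_defined: "\<And>\<omega> i. \<omega> \<in> \<Omega> \<Longrightarrow> i \<in> ordering_nodes N E \<Longrightarrow>
        \<i> * of_real \<omega> + of_real (K i) * W \<omega> i \<noteq> 0"
    and sigma: "\<And>\<omega>. \<sigma> \<omega> = network_gain N E \<beta> \<tau>0 w \<delta> K \<omega>"
    and simple: "\<And>\<omega>. \<omega> \<in> \<Omega> \<Longrightarrow>
        sigma_max_simple (transfer_matrix N E \<beta> \<tau> w K (\<i> * of_real \<omega>))"
    and eta: "\<And>\<omega>. \<omega> \<in> \<Omega> \<Longrightarrow>
        unit_left_singular_vector (transfer_matrix N E \<beta> \<tau> w K (\<i> * of_real \<omega>))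
          (\<sigma> \<omega>) (node_vec N E (\<eta> \<omega>))"
    and q: "\<And>\<omega> i. q \<omega> i = of_real (\<sigma> \<omega>) * \<eta> \<omega> i"
    and c: "\<And>\<omega>. c \<omega> = exp (\<rho> * \<sigma> \<omega>) / (\<Sum>\<omega>'\<in>\<Omega>. exp (\<rho> * \<sigma> \<omega>'))"
    and T\<psi>: "\<And>\<omega> j. T\<psi> \<omega> j = (if j \<in> source_nodes N E then 0 else T \<omega> j * \<psi> \<omega> j)"
    and psi: "\<And>\<omega> i. \<omega> \<in> \<Omega> \<Longrightarrow> i \<in> ordering_nodes N E \<Longrightarrow>
        \<psi> \<omega> i = of_real (c \<omega>) * cnj (\<eta> \<omega> i) + (\<Sum>j\<in>suppliers E i. of_real (w (i, j)) * T\<psi> \<omega> j)"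
    and Lambda: "\<And>\<omega> i. \<Lambda> \<omega> i =
        - (of_real (K i) * T \<omega> i * q \<omega> i / (\<i> * of_real \<omega> + of_real (K i)) * \<psi> \<omega> i)"
  shows "(\<forall>i j. (i, j) \<in> E \<longrightarrow>
      ((\<lambda>x. smooth_peak_gain N E \<beta> \<tau>0 \<Omega> \<rho> (w((i, j) := x)) \<delta> K) has_real_derivative
        (\<Sum>\<omega>\<in>\<Omega>. Re (of_real (1 - \<beta> i) * exp (- (\<i> * of_real \<omega> * of_real (\<tau> (i, j)))) * \<Lambda> \<omega> i
                     + T\<psi> \<omega> j * q \<omega> i))) (at (w (i, j))) \<and>
      ((\<lambda>x. smooth_peak_gain N E \<beta> \<tau>0 \<Omega> \<rho> w (\<delta>((i, j) := x)) K) has_real_derivative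
        (\<Sum>\<omega>\<in>\<Omega>. Re (\<i> * of_real \<omega> * of_real (1 - \<beta> i) * of_real (w (i, j))
                     * exp (- (\<i> * of_real \<omega> * of_real (\<tau> (i, j)))) * \<Lambda> \<omega> i))) (at (\<delta> (i, j)))) \<and>
    (\<forall>i\<in>ordering_nodes N E.
      ((\<lambda>x. smooth_peak_gain N E \<beta> \<tau>0 \<Omega> \<rho> w \<delta> (K(i := x))) has_real_derivative
        (\<Sum>\<omega>\<in>\<Omega>. Re (\<i> * of_real \<omega> * (1 - W \<omega> i) * T \<omega> i * q \<omega> i
                     / (\<i> * of_real \<omega> + of_real (K i))\<^sup>2 * \<psi> \<omega> i))) (at (K i)))"
proof -
  define R where "R = ordering_nodes N E"
  define s where "s = (\<lambda>\<omega>::real. \<i> * complex_of_real \<omega>)"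
  have EN: "E \<subseteq> N \<times> N" using edges by auto
  have finR: "finite R" using finite_nodes by (simp add: R_def ordering_nodes_def)
  have fin_supp: "finite (suppliers E i)" for i
    by (rule finite_subset[OF _ finite_nodes]) (use EN in \<open>auto simp: suppliers_def\<close>)
  have edgeR: "i \<in> R" if "(i, j) \<in> E" for i j
    using that EN by (auto simp: R_def ordering_nodes_def source_nodes_def suppliers_def)
  \<comment> \<open>\<open>s \<omega>\<close> is purely imaginary, so the real part of the sum is
    \<open>K i > 0\<close>.\<close>
  have num: "s \<omega> + of_real (K i) \<noteq> 0" if "i \<in> R" for \<omega> i
    using K_pos[of i] that by (auto simp: R_def s_def complex_eq_iff)
  have den: "s \<omega> + of_real (K i) * W \<omega> i \<noteq> 0" if "\<omega> \<in> \<Omega>" "i \<in> R" for \<omega> i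
    using T_defined that by (auto simp: R_def s_def)
  have T_eq: "T \<omega> i = (s \<omega> + of_real (K i)) / (s \<omega> + of_real (K i) * W \<omega> i)" for \<omega> i
    by (simp add: T W node_transfer_def s_def)
  have T0: "T \<omega> i \<noteq> 0" if "\<omega> \<in> \<Omega>" "i \<in> R" for \<omega> i
    using num den that by (simp add: T_eq)
  have \<sigma>_eq: "\<sigma> = network_gain N E \<beta> \<tau>0 w \<delta> K" using sigma by (rule ext)
  \<comment> \<open>The gradient formula along an arbitrary path through the design point. Each
    partial derivative below only has to supply \<open>tr'\<close> and \<open>w'\<close> and to
    evaluate the sum over the nodes.\<close>
  have path: "((\<lambda>x. smooth_peak_gain N E \<beta> \<tau>0 \<Omega> \<rho> (wx x) (\<delta>x x) (Kx x)) has_real_derivative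
      (\<Sum>\<omega>\<in>\<Omega>. Re (\<Sum>j\<in>R. \<psi> \<omega> j * (tr' \<omega> j / T \<omega> j * q \<omega> j +
        T \<omega> j * (\<Sum>k\<in>customers E j. of_real (w' (k, j)) * q \<omega> k))))) (at x0)"
    if R: "R \<noteq> {}" and eqs: "wx x0 = w" "\<delta>x x0 = \<delta>" "Kx x0 = K"
      and tr: "\<And>\<omega> j. \<omega> \<in> \<Omega> \<Longrightarrow> j \<in> R \<Longrightarrow>
        ((\<lambda>x. node_transfer E \<beta> (lead_time \<tau>0 (\<delta>x x)) (wx x) (Kx x) j (s \<omega>)) has_vector_derivative tr' \<omega> j) (at x0)"
      and w': "\<And>e. e \<in> E \<Longrightarrow> ((\<lambda>x. wx x e) has_real_derivative w' e) (at x0)"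
    for wx \<delta>x Kx tr' w' x0
  proof (rule smooth_peak_gain_has_derivative[OF grid rho, where \<sigma> = \<sigma>])
    show "\<sigma> = network_gain N E \<beta> \<tau>0 (wx x0) (\<delta>x x0) (Kx x0)" by (simp only: eqs \<sigma>_eq)
    fix \<omega> assume \<omega>: "\<omega> \<in> \<Omega>"
    have sig: "sigma_max (transfer_matrix N E \<beta> (lead_time \<tau>0 \<delta>) w K (s \<omega>)) = \<sigma> \<omega>"
      by (simp add: sigma network_gain_def s_def)
    have "(\<Sum>\<omega>'\<in>\<Omega>. exp (\<rho> * \<sigma> \<omega>')) > 0" using grid by (intro sum_pos) auto
    then have c0: "c \<omega> \<noteq> 0" by (simp add: c)
    show "((\<lambda>x. network_gain N E \<beta> \<tau>0 (wx x) (\<delta>x x) (Kx x) \<omega>) has_real_derivative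
        Re (\<Sum>j\<in>R. \<psi> \<omega> j * (tr' \<omega> j / T \<omega> j * q \<omega> j +
          T \<omega> j * (\<Sum>k\<in>customers E j. of_real (w' (k, j)) * q \<omega> k))) /
        (exp (\<rho> * \<sigma> \<omega>) / (\<Sum>\<omega>'\<in>\<Omega>. exp (\<rho> * \<sigma> \<omega>')))) (at x0)"
      unfolding network_gain_def c[symmetric] R_def s_def[symmetric]
    proof (rule network_gain_has_derivative[where \<tau> = "\<lambda>x. lead_time \<tau>0 (\<delta>x x)" and w = wx and K = Kx
          and s = "s \<omega>" and \<eta> = "\<eta> \<omega>" and N = N and E = E and \<beta> = \<beta>])
      show "\<psi> \<omega> i = of_real (c \<omega>) * cnj (\<eta> \<omega> i) + (\<Sum>j\<in>suppliers E i. of_real (wx x0 (i, j)) *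
          (if j \<in> source_nodes N E then 0 else T \<omega> j * \<psi> \<omega> j))" if "i \<in> ordering_nodes N E" for i
        using psi[OF \<omega> that] by (simp add: T\<psi> eqs)
    qed (use finite_nodes EN topological R tr w' T T0 simple eta q c0 \<omega> in
        \<open>auto simp: R_def s_def sig[unfolded s_def] eqs tau\<close>)
  qed
  show ?thesis
  proof (intro conjI allI impI ballI)
    fix i j assume e: "(i, j) \<in> E"
    then have i: "i \<in> R" by (rule edgeR)
    then have R: "R \<noteq> {}" by auto
    show "((\<lambda>x. smooth_peak_gain N E \<beta> \<tau>0 \<Omega> \<rho> (w((i, j) := x)) \<delta> K) has_real_derivative
        (\<Sum>\<omega>\<in>\<Omega>. Re (of_real (1 - \<beta> i) * exp (- (\<i> * of_real \<omega> * of_real (\<tau> (i, j)))) * \<Lambda> \<omega> i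
                     + T\<psi> \<omega> j * q \<omega> i))) (at (w (i, j)))"
    proof -
      define W' where "W' = (\<lambda>\<omega>. of_real (1 - \<beta> i) * exp (- (s \<omega> * of_real (\<tau> (i, j)))))"
      \<comment> \<open>A weight acts in two ways: through \<open>W\<close> of its own customer
        \<open>i\<close>, the only node whose transfer function changes, and through
        \<open>w'\<close> in the demand that \<open>i\<close> passes on to \<open>j\<close>. They
        give the \<Lambda> term and the \<open>T\<psi>\<close> term respectively.\<close>
      define tr' where "tr' = (\<lambda>\<omega> l. if l = i then - (of_real (K i) * W' \<omega> * T \<omega> i / (s \<omega> + of_real (K i))) * T \<omega> i else 0)"
      define w' where "w' = (\<lambda>e. if e = (i, j) then 1 else 0 :: real)"
      have tr: "((\<lambda>x. node_transfer E \<beta> (lead_time \<tau>0 \<delta>) (w((i, j) := x)) K l (s \<omega>)) has_vector_derivative tr' \<omega> l)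
          (at (w (i, j)))" if \<omega>: "\<omega> \<in> \<Omega>" and l: "l \<in> R" for \<omega> l
      proof (cases "l = i")
        case True
        have "((\<lambda>z. W \<omega> i + of_real (1 - \<beta> i) * (z - of_real (w (i, j))) * exp (- (s \<omega> * of_real (\<tau> (i, j)))))
            has_field_derivative W' \<omega>) (at (of_real (w (i, j))))"
          unfolding W'_def by (auto intro!: derivative_eq_intros)
        from node_transfer_has_derivative[OF this, of "s \<omega>" "of_real (K i)" "T \<omega> i"] den[OF \<omega> i] num[OF i]
        have "((\<lambda>z. (s \<omega> + of_real (K i)) / (s \<omega> + of_real (K i) * (W \<omega> i +
            of_real (1 - \<beta> i) * (z - of_real (w (i, j))) * exp (- (s \<omega> * of_real (\<tau> (i, j)))))))
            has_field_derivative tr' \<omega> i) (at (of_real (w (i, j))))"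
          by (simp add: T_eq tr'_def)
        from has_vector_derivative_real_field[OF this] show ?thesis
          unfolding True node_transfer_def supply_weight_upd_weight[OF fin_supp e]
          by (simp only: W tau s_def)
      next
        case False
        then have "node_transfer E \<beta> (lead_time \<tau>0 \<delta>) (w((i, j) := x)) K l (s \<omega>) =
            node_transfer E \<beta> (lead_time \<tau>0 \<delta>) w K l (s \<omega>)" for x
          by (simp add: node_transfer_def supply_weight_def)
        then show ?thesis using False by (simp add: tr'_def)
      qed
      have "((\<lambda>x. (w((i, j) := x)) e) has_real_derivative w' e) (at (w (i, j)))" for e
        by (cases "e = (i, j)") (auto simp: w'_def)
      note deriv = path[where wx = "\<lambda>x. w((i, j) := x)" and \<delta>x = "\<lambda>_. \<delta>" and Kx = "\<lambda>_. K", OF R fun_upd_triv refl refl tr this]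
      have "(\<Sum>l\<in>R. \<psi> \<omega> l * (tr' \<omega> l / T \<omega> l * q \<omega> l +
          T \<omega> l * (\<Sum>k\<in>customers E l. of_real (w' (k, l)) * q \<omega> k))) =
          of_real (1 - \<beta> i) * exp (- (\<i> * of_real \<omega> * of_real (\<tau> (i, j)))) * \<Lambda> \<omega> i + T\<psi> \<omega> j * q \<omega> i"
        if \<omega>: "\<omega> \<in> \<Omega>" for \<omega>
      proof -
        have inner: "(\<Sum>k\<in>customers E l. of_real (w' (k, l)) * q \<omega> k) = (if l = j then q \<omega> i else 0)" for l
        proof -
          have "finite (customers E l)"
            using finR by (simp add: customers_eq_ordering[OF EN] R_def)
          moreover have "(\<Sum>k\<in>customers E l. of_real (w' (k, l)) * q \<omega> k) =
              (\<Sum>k\<in>customers E l. if k = i then (if l = j then q \<omega> i else 0) else 0)"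
            by (rule sum.cong) (auto simp: w'_def)
          ultimately show ?thesis using e by (auto simp: customers_def)
        qed
        have "(\<Sum>l\<in>R. \<psi> \<omega> l * (tr' \<omega> l / T \<omega> l * q \<omega> l + T \<omega> l * (if l = j then q \<omega> i else 0))) =
            (\<Sum>l\<in>R. if l = i then \<psi> \<omega> i * (tr' \<omega> i / T \<omega> i * q \<omega> i) else 0) +
            (\<Sum>l\<in>R. if l = j then \<psi> \<omega> j * T \<omega> j * q \<omega> i else 0)"
          unfolding sum.distrib[symmetric]
          by (rule sum.cong) (auto simp: tr'_def algebra_simps)
        moreover have "\<psi> \<omega> i * (tr' \<omega> i / T \<omega> i * q \<omega> i) =
            of_real (1 - \<beta> i) * exp (- (\<i> * of_real \<omega> * of_real (\<tau> (i, j)))) * \<Lambda> \<omega> i"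
          using T0[OF \<omega> i] by (simp add: tr'_def W'_def Lambda s_def)
        \<comment> \<open>If \<open>j\<close> is a source it is not among the summation indices,
          which agrees with the convention that \<open>T\<psi>\<close> is 0 there.\<close>
        moreover have "(if j \<in> R then \<psi> \<omega> j * T \<omega> j * q \<omega> i else 0) = T\<psi> \<omega> j * q \<omega> i"
          using e EN by (auto simp: T\<psi> R_def ordering_nodes_def)
        ultimately show ?thesis unfolding inner using finR i by simp
      qed
      with deriv show ?thesis by (simp only: cong: sum.cong)
    qed
    show "((\<lambda>x. smooth_peak_gain N E \<beta> \<tau>0 \<Omega> \<rho> w (\<delta>((i, j) := x)) K) has_real_derivative
        (\<Sum>\<omega>\<in>\<Omega>. Re (\<i> * of_real \<omega> * of_real (1 - \<beta> i) * of_real (w (i, j))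
                     * exp (- (\<i> * of_real \<omega> * of_real (\<tau> (i, j)))) * \<Lambda> \<omega> i))) (at (\<delta> (i, j)))"
    proof -
      \<comment> \<open>The exponent is \<open>- s (\<tau>0 - \<delta>)\<close>, so differentiating
        in \<delta> brings down \<open>+ s\<close>. A delay does not occur in the demand equations;
        hence \<open>w'\<close> is 0 and only node \<open>i\<close> contributes.\<close>
      define W' where "W' = (\<lambda>\<omega>. of_real (1 - \<beta> i) * of_real (w (i, j)) * (s \<omega> * exp (- (s \<omega> * of_real (\<tau> (i, j))))))"
      define tr' where "tr' = (\<lambda>\<omega> l. if l = i then - (of_real (K i) * W' \<omega> * T \<omega> i / (s \<omega> + of_real (K i))) * T \<omega> i else 0)"
      have tr: "((\<lambda>x. node_transfer E \<beta> (lead_time \<tau>0 (\<delta>((i, j) := x))) w K l (s \<omega>)) has_vector_derivative tr' \<omega> l)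
          (at (\<delta> (i, j)))" if \<omega>: "\<omega> \<in> \<Omega>" and l: "l \<in> R" for \<omega> l
      proof (cases "l = i")
        case True
        have \<tau>e: "of_real (\<tau> (i, j)) = complex_of_real (\<tau>0 (i, j)) - of_real (\<delta> (i, j))"
          by (simp add: tau lead_time_def)
        have "((\<lambda>z. W \<omega> i + of_real (1 - \<beta> i) * of_real (w (i, j)) *
              (exp (- (s \<omega> * (of_real (\<tau>0 (i, j)) - z))) - exp (- (s \<omega> * of_real (\<tau> (i, j))))))
            has_field_derivative W' \<omega>) (at (of_real (\<delta> (i, j))))"
          unfolding W'_def \<tau>e by (auto intro!: derivative_eq_intros)
        from node_transfer_has_derivative[OF this, of "s \<omega>" "of_real (K i)" "T \<omega> i"] den[OF \<omega> i] num[OF i]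
        have "((\<lambda>z. (s \<omega> + of_real (K i)) / (s \<omega> + of_real (K i) * (W \<omega> i + of_real (1 - \<beta> i) * of_real (w (i, j)) *
              (exp (- (s \<omega> * (of_real (\<tau>0 (i, j)) - z))) - exp (- (s \<omega> * of_real (\<tau> (i, j))))))))
            has_field_derivative tr' \<omega> i) (at (of_real (\<delta> (i, j))))"
          by (simp add: T_eq tr'_def \<tau>e)
        from has_vector_derivative_real_field[OF this] show ?thesis
          unfolding True node_transfer_def supply_weight_upd_lead_time[OF fin_supp e]
          by (simp only: W tau s_def)
      next
        case False
        then have "node_transfer E \<beta> (lead_time \<tau>0 (\<delta>((i, j) := x))) w K l (s \<omega>) =
            node_transfer E \<beta> (lead_time \<tau>0 \<delta>) w K l (s \<omega>)" for x
          by (simp add: node_transfer_def supply_weight_def lead_time_def)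
        then show ?thesis using False by (simp add: tr'_def)
      qed
      have "((\<lambda>x. w e) has_real_derivative 0) (at (\<delta> (i, j)))" for e by simp
      note deriv = path[where wx = "\<lambda>_. w" and \<delta>x = "\<lambda>x. \<delta>((i, j) := x)" and Kx = "\<lambda>_. K" and w' = "\<lambda>_. 0", OF R refl fun_upd_triv refl tr this]
      have "(\<Sum>l\<in>R. \<psi> \<omega> l * (tr' \<omega> l / T \<omega> l * q \<omega> l +
          T \<omega> l * (\<Sum>k\<in>customers E l. of_real 0 * q \<omega> k))) =
          \<i> * of_real \<omega> * of_real (1 - \<beta> i) * of_real (w (i, j)) * exp (- (\<i> * of_real \<omega> * of_real (\<tau> (i, j)))) * \<Lambda> \<omega> i"
        if \<omega>: "\<omega> \<in> \<Omega>" for \<omega>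
      proof -
        have "(\<Sum>l\<in>R. \<psi> \<omega> l * (tr' \<omega> l / T \<omega> l * q \<omega> l + T \<omega> l * (\<Sum>k\<in>customers E l. of_real 0 * q \<omega> k))) =
            (\<Sum>l\<in>R. if l = i then \<psi> \<omega> i * (tr' \<omega> i / T \<omega> i * q \<omega> i) else 0)"
          by (rule sum.cong) (auto simp: tr'_def)
        moreover have "\<psi> \<omega> i * (tr' \<omega> i / T \<omega> i * q \<omega> i) =
            \<i> * of_real \<omega> * of_real (1 - \<beta> i) * of_real (w (i, j)) * exp (- (\<i> * of_real \<omega> * of_real (\<tau> (i, j)))) * \<Lambda> \<omega> i"
          using T0[OF \<omega> i] by (simp add: tr'_def W'_def Lambda s_def)
        ultimately show ?thesis using finR i by simp
      qed
      with deriv show ?thesis by (simp only: cong: sum.cong)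
    qed
  next
    fix i assume "i \<in> ordering_nodes N E"
    then have i: "i \<in> R" by (simp add: R_def)
    then have R: "R \<noteq> {}" by auto
    \<comment> \<open>The gain \<open>K i\<close> enters the transfer function of node
      \<open>i\<close> alone, and no weight changes.\<close>
    define tr' where "tr' = (\<lambda>\<omega> l. if l = i then s \<omega> * (1 - W \<omega> i) * T \<omega> i / (s \<omega> + of_real (K i))\<^sup>2 * T \<omega> i else 0)"
    have tr: "((\<lambda>x. node_transfer E \<beta> (lead_time \<tau>0 \<delta>) w (K(i := x)) l (s \<omega>)) has_vector_derivative tr' \<omega> l)
        (at (K i))" if \<omega>: "\<omega> \<in> \<Omega>" and l: "l \<in> R" for \<omega> l
    proof (cases "l = i")
      case True
      from has_vector_derivative_real_field[OF node_transfer_has_derivative_gain[OF den[OF \<omega> i] num[OF i] T_eq]]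
      show ?thesis
        by (simp add: True tr'_def node_transfer_def W tau s_def)
    next
      case False
      then show ?thesis by (simp add: tr'_def node_transfer_def)
    qed
    have "((\<lambda>x. w e) has_real_derivative 0) (at (K i))" for e by simp
    note deriv = path[where wx = "\<lambda>_. w" and \<delta>x = "\<lambda>_. \<delta>" and Kx = "\<lambda>x. K(i := x)" and w' = "\<lambda>_. 0", OF R refl refl fun_upd_triv tr this]
    have "(\<Sum>l\<in>R. \<psi> \<omega> l * (tr' \<omega> l / T \<omega> l * q \<omega> l +
        T \<omega> l * (\<Sum>k\<in>customers E l. of_real 0 * q \<omega> k))) =
        \<i> * of_real \<omega> * (1 - W \<omega> i) * T \<omega> i * q \<omega> i / (\<i> * of_real \<omega> + of_real (K i))\<^sup>2 * \<psi> \<omega> i"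
      if \<omega>: "\<omega> \<in> \<Omega>" for \<omega>
    proof -
      have "(\<Sum>l\<in>R. \<psi> \<omega> l * (tr' \<omega> l / T \<omega> l * q \<omega> l + T \<omega> l * (\<Sum>k\<in>customers E l. of_real 0 * q \<omega> k))) =
          (\<Sum>l\<in>R. if l = i then \<psi> \<omega> i * (tr' \<omega> i / T \<omega> i * q \<omega> i) else 0)"
        by (rule sum.cong) (auto simp: tr'_def)
      moreover have "\<psi> \<omega> i * (tr' \<omega> i / T \<omega> i * q \<omega> i) =
          \<i> * of_real \<omega> * (1 - W \<omega> i) * T \<omega> i * q \<omega> i / (\<i> * of_real \<omega> + of_real (K i))\<^sup>2 * \<psi> \<omega> i"
        using T0[OF \<omega> i] by (simp add: tr'_def s_def)
      ultimately show ?thesis using finR i by simp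
    qed
    with deriv show "((\<lambda>x. smooth_peak_gain N E \<beta> \<tau>0 \<Omega> \<rho> w \<delta> (K(i := x))) has_real_derivative
        (\<Sum>\<omega>\<in>\<Omega>. Re (\<i> * of_real \<omega> * (1 - W \<omega> i) * T \<omega> i * q \<omega> i
                     / (\<i> * of_real \<omega> + of_real (K i))\<^sup>2 * \<psi> \<omega> i))) (at (K i))"
      by (simp only: cong: sum.cong)
  qed
qed

end
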